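(* Let $q$ be a power of an odd prime and put $N=q+1$. Define $I_q(B,C)=(-1)^{N/2}\,\mathcal V_{N/2}(B,C)$ and $P_q(B,C)=\Lambda_N(B,C)$ in $\mathbb F_q[B,C]$. Then for every primitive element $c$ of $\mathbb F_q$: (1) $I_q(B,c)\in\mathbb F_q[B]$ has $N/2$ roots in $\mathbb F_q$, which are exactly the coefficients $b\in\mathbb F_q$ for which $X^2+bX+c$ is irreducible over $\mathbb F_q$; (2) $P_q(B,c)\in\mathbb F_q[B]$ has $\varphi(N)$ roots in $\mathbb F_q$, which are exactly the coefficients $b\in\mathbb F_q$ for which $X^2+bX+c$ is primitive over $\mathbb F_q$. Therefore $P_q(B,C)$ is an optimal determining polynomial for primitive quadratic polynomials over $\mathbb F_q$.
   Context: $\varphi$ is Euler's totient function. A primitive element of $\mathbb F_q$ is a generator of $\mathbb F_q^*$. A monic polynomial of degree $k\ge 1$ over $\mathbb F_q$ is primitive if it is the minimal polynomial over $\mathbb F_q$ of a generator of $\mathbb F_{q^k}^*$. Lucas polynomials: let $B,C$ be algebraically independent indeterminates over $\mathbb F_q$. Define $\mathcal V_0=2$, $\mathcal V_1=-B$, $\mathcal V_n=-B\,\mathcal V_{n-1}-C\,\mathcal V_{n-2}$ for $n\ge 2$ (Lucas polynomials of the second type). Lucas atoms: let $\alpha,\beta$ be the two roots of $T^2+BT+C$ in an algebraic closure of $\mathbb F_q(B,C)$. Let $\Phi_n(X)\in\mathbb F_q[X]$ be the $n$-th cyclotomic polynomial (the image of the integral one) and $\Phi_n^{\mathrm{hom}}(\alpha,\beta)=\beta^{\varphi(n)}\Phi_n(\alpha/\beta)$.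 For $n\ge 2$ the $n$-th Lucas atom $\Lambda_n(B,C)\in\mathbb F_q[B,C]$ is the unique polynomial with $\Lambda_n(B,C)=\Phi_n^{\mathrm{hom}}(\alpha,\beta)$; $\Lambda_1=1$. A polynomial $P(B,C)\in\mathbb F_q[B,C]$ is called an optimal determining polynomial for primitive quadratic polynomials over $\mathbb F_q$ if for every primitive element $c$ of $\mathbb F_q$ the polynomial $P(B,c)\in\mathbb F_q[B]$ is monic and square-free and its roots are exactly the $b\in\mathbb F_q$ for which $X^2+bX+c$ is primitive, i.e. $P(B,c)=\prod_{b}(B-b)$, the product being over all $b\in\mathbb F_q$ with $X^2+bX+c$ primitive over $\mathbb F_q$. *)

theory Defs
  imports
    "HOL-Algebra.Algebraic_Closure_Type"
    "HOL-Number_Theory.Totient"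
    "HOL-Library.Cardinality"
begin

text \<open>
  The field \<open>F\<^sub>q\<close> is a type \<open>'a\<close> of class \<open>finite_field\<close>, with \<open>q = CARD('a)\<close>.
  The ring \<open>F\<^sub>q[B,C]\<close> is \<open>'a poly poly\<close>, read as \<open>(F\<^sub>q[C])[B]\<close>: the outer variable is \<open>B\<close>,
  the inner one is \<open>C\<close>.
\<close>

definition indet_B :: "'a::comm_ring_1 poly poly"
  where "indet_B = [:0, 1:]"

definition indet_C :: "'a::comm_ring_1 poly poly"
  where "indet_C = [:[:0, 1:]:]"

definition subst_C :: "'a::comm_ring_1 poly poly \<Rightarrow> 'a \<Rightarrow> 'a poly"
  where "subst_C P c = map_poly (\<lambda>a. poly a c) P"


definition generates_units :: "'k::field set \<Rightarrow> 'k \<Rightarrow> bool"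
  where "generates_units K g \<longleftrightarrow> range (\<lambda>n::int. g powi n) = K - {0}"

definition primitive_element :: "'a::finite_field \<Rightarrow> bool"
  where "primitive_element c \<longleftrightarrow> generates_units UNIV c"

text \<open>
  The subfield of order \<open>q\<^sup>k\<close> of the algebraic closure of \<open>F\<^sub>q\<close>, for \<open>k \<ge> 1\<close>: the set of
  roots of \<open>X\<^bsup>q^k\<^esup> - X\<close>, which is also the splitting field of that polynomial.
\<close>
definition field_extension :: "nat \<Rightarrow> 'a::finite_field alg_closure set"
  where "field_extension k = {x. x ^ (CARD('a) ^ k) = x}"

definition is_minimal_polynomial :: "'a::field poly \<Rightarrow> 'a alg_closure \<Rightarrow> bool"
  where "is_minimal_polynomial f x \<longleftrightarrow>
    Polynomial.lead_coeff f = 1 \<and> poly (map_poly to_ac f) x = 0 \<and>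
    (\<forall>g. g \<noteq> 0 \<and> poly (map_poly to_ac g) x = 0
          \<longrightarrow> Polynomial.degree f \<le> Polynomial.degree g)"

definition primitive_polynomial :: "'a::finite_field poly \<Rightarrow> bool"
  where "primitive_polynomial f \<longleftrightarrow>
    Polynomial.lead_coeff f = 1 \<and> Polynomial.degree f \<ge> 1 \<and>
    (\<exists>x. generates_units (field_extension (Polynomial.degree f)) x \<and> is_minimal_polynomial f x)"


fun lucas_V :: "nat \<Rightarrow> 'a::comm_ring_1 poly poly" where
  "lucas_V 0 = 2"
| "lucas_V (Suc 0) = - indet_B"
| "lucas_V (Suc (Suc n)) = - indet_B * lucas_V (Suc n) - indet_C * lucas_V n"


text \<open>The product over the primitive \<open>n\<close>-th roots of unity in the complex numbers has integer
  coefficients.\<close>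
definition int_cyclotomic :: "nat \<Rightarrow> int poly"
  where "int_cyclotomic n = (THE p. map_poly (of_int :: int \<Rightarrow> complex) p =
    (\<Prod>k\<in>totatives n. [:- cis (2 * pi * real k / real n), 1:]))"

definition cyclotomic :: "nat \<Rightarrow> 'a::comm_ring_1 poly"
  where "cyclotomic n = map_poly of_int (int_cyclotomic n)"

definition cyclotomic_hom :: "nat \<Rightarrow> 'k::field \<Rightarrow> 'k \<Rightarrow> 'k"
  where "cyclotomic_hom n \<alpha> \<beta> = \<beta> ^ totient n * poly (cyclotomic n) (\<alpha> / \<beta>)"

definition to_closure :: "'a::field poly poly \<Rightarrow> 'a poly poly fract alg_closure"
  where "to_closure P = to_ac (to_fract P)"

text \<open>
  Since \<open>\<Phi>\<^sub>n\<close> is palindromic for \<open>n \<ge> 2\<close>, the two orderings of the roots \<open>\<alpha>\<close>, \<open>\<beta>\<close> give the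
  same value; the quantifier ranges over both.  The value at \<open>n = 0\<close> is irrelevant.
\<close>
definition lucas_atom :: "nat \<Rightarrow> 'a::field poly poly"
  where "lucas_atom n = (if n = 1 then 1 else
    (THE L. \<forall>\<alpha> \<beta>. [:to_closure indet_C, to_closure indet_B, 1:] = [:- \<alpha>, 1:] * [:- \<beta>, 1:]
       \<longrightarrow> to_closure L = cyclotomic_hom n \<alpha> \<beta>))"


text \<open>The product formula says that all roots of \<open>P(B,c)\<close>, including those in extensions of
  \<open>F\<^sub>q\<close>, are the indicated elements of \<open>F\<^sub>q\<close>.\<close>
definition optimal_determining_polynomial :: "'a::finite_field poly poly \<Rightarrow> bool"
  where "optimal_determining_polynomial P \<longleftrightarrow>
    (\<forall>c. primitive_element c \<longrightarrow>
       Polynomial.lead_coeff (subst_C P c) = 1 \<and>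
       squarefree (subst_C P c) \<and>
       {b. poly (subst_C P c) b = 0} = {b. primitive_polynomial [:c, b, 1:]} \<and>
       subst_C P c = (\<Prod>b | primitive_polynomial [:c, b, 1:]. [:- b, 1:]))"

end

(* Let c be primitive and let x, y be the roots of X^2 + bX + c in the algebraic closure, so that xy = c.
   Since V_n(b,c) = x^n + y^n, and the Lucas atom at (b,c) is y^phi(N) Phi_N(x/y), the roots b of the
   two polynomials are given by conditions on z = x/y = x^2/c: z^(N/2) = -1 in the first case, z of
   order N in the second.  As c is a nonsquare, c^(N/2) = -c, so z^(N/2) = -1 says that x^q = y.
   This is irreducibility of the quadratic polynomial; and then x^(q-1) = 1/z and x^(q+1) = c show that
   x has order q^2 - 1 exactly when z has order N.  Every z with z^(N/2) = -1 comes from two values of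
   x, and every b from the two values x and c/x, so that there are as many b as z.  The Lucas atom,
   being monic in B of degree phi(N), is then the product of the B - b. *)
theory Submission
  imports Defs "HOL-Computational_Algebra.Fundamental_Theorem_Algebra"
begin

section \<open>Ring morphisms and polynomials\<close>

text \<open>The Lucas atom is described by roots in a closure of F_q(B,C), where b and c cannot be
  substituted. It is therefore exhibited as an explicit element of F_q[B,C],
  \<open>lucas_atom_expansion\<close>, by an identity valid under every ring morphism to a field:
  \<open>to_closure\<close> identifies the atom with it, and evaluation at (b,c) gives the value at
  the roots x and y. The cyclotomic polynomials raise a similar obstacle, being given as complex
  products. The factorisation of X^n - 1 into the \<Phi>_d with d | n is descended to the integers
  and mapped to every ring. Over the closure of F_q it still determines the roots of \<Phi>_N,
  because N = q + 1 equals 1 there and X^N - 1 has only simple roots.\<close>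

locale ring_morphism =
  fixes h :: "'a::comm_ring_1 \<Rightarrow> 'b::comm_ring_1"
  assumes hom_add: "h (x + y) = h x + h y"
    and hom_mult: "h (x * y) = h x * h y"
    and hom_one: "h 1 = 1"
begin

lemma hom_zero: "h 0 = 0"
  using hom_add[of 0 0] by simp

lemma hom_uminus: "h (- x) = - h x"
  using hom_add[of x "- x"] hom_zero by (simp add: eq_neg_iff_add_eq_0 add.commute)

lemma hom_diff: "h (x - y) = h x - h y"
  using hom_add[of x "- y"] by (simp add: hom_uminus)

lemma hom_sum: "h (sum f A) = (\<Sum>x\<in>A. h (f x))"
  by (induction A rule: infinite_finite_induct) (auto simp: hom_zero hom_add)

lemma hom_prod: "h (prod f A) = (\<Prod>x\<in>A. h (f x))"
  by (induction A rule: infinite_finite_induct) (auto simp: hom_one hom_mult)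

lemma hom_power: "h (x ^ n) = h x ^ n"
  by (induction n) (auto simp: hom_one hom_mult)

lemma hom_of_nat: "h (of_nat n) = of_nat n"
  by (induction n) (auto simp: hom_zero hom_one hom_add)

lemma hom_of_int: "h (of_int n) = of_int n"
  by (cases n rule: int_cases2) (auto simp: hom_of_nat hom_uminus)

lemma coeff_map: "Polynomial.coeff (map_poly h p) i = h (Polynomial.coeff p i)"
  by (simp add: coeff_map_poly hom_zero)

lemma map_poly_morphism: "ring_morphism (map_poly h)"
proof
  fix p q
  show "map_poly h (p + q) = map_poly h p + map_poly h q"
    by (rule poly_eqI) (simp add: coeff_map hom_add)
  show "map_poly h (p * q) = map_poly h p * map_poly h q"
    by (rule poly_eqI) (simp add: coeff_map coeff_mult hom_sum hom_mult)
qed (simp add: hom_one)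

end

lemma of_int_morphism: "ring_morphism of_int"
  by standard auto

lemma to_ac_morphism: "ring_morphism to_ac"
  by standard auto

lemma poly_eval_morphism: "ring_morphism (\<lambda>p. poly p c)"
  by standard auto

lemma subst_C_morphism: "ring_morphism (\<lambda>P. subst_C P c)"
  unfolding subst_C_def by (rule ring_morphism.map_poly_morphism[OF poly_eval_morphism])

lemma to_closure_morphism: "ring_morphism to_closure"
  unfolding to_closure_def by standard simp_all

lemma ring_morphism_comp:
  assumes "ring_morphism f" "ring_morphism g"
  shows "ring_morphism (\<lambda>x. f (g x))"
  using assms by (simp add: ring_morphism_def)

lemma map_poly_of_int_eq_iff:
  "map_poly (of_int :: int \<Rightarrow> 'a::{comm_ring_1,ring_char_0}) p = map_poly of_int q \<longleftrightarrow> p = q"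
  by (auto simp: poly_eq_iff coeff_map_poly)

text \<open>Two monic polynomials of degree \<open>card A\<close> that agree on \<open>A\<close>
  differ by a polynomial of smaller degree with \<open>card A\<close> roots. Used for X^n - 1 over
  the complex numbers and for the specialised Lucas atom.\<close>

lemma monic_eq_prod_roots:
  fixes p :: "'a::idom poly"
  assumes "Polynomial.lead_coeff p = 1" "finite A" "card A = Polynomial.degree p"
    and "\<And>a. a \<in> A \<Longrightarrow> poly p a = 0"
  shows "p = (\<Prod>a\<in>A. [:- a, 1:])"
proof (rule poly_eqI_degree_lead_coeff)
  have deg: "Polynomial.degree (\<Prod>a\<in>A. [:- a, 1:]) = card A"
    by (subst degree_prod_sum_eq) auto
  have "Polynomial.lead_coeff (\<Prod>a\<in>A. [:- a, 1:]) = 1"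
    by (simp add: lead_coeff_prod)
  then show "Polynomial.coeff p (card A) = Polynomial.coeff (\<Prod>a\<in>A. [:- a, 1:]) (card A)"
    using assms deg by simp
  show "Polynomial.degree (\<Prod>a\<in>A. [:- a, 1:]) \<le> card A"
    using deg by simp
  show "Polynomial.degree p \<le> card A" "card A \<ge> card A"
    using assms by simp_all
  show "poly p z = poly (\<Prod>a\<in>A. [:- a, 1:]) z" if "z \<in> A" for z
    using assms that by (auto simp: poly_prod)
qed

lemma poly_prod_linear_eq_0_iff:
  "finite A \<Longrightarrow> poly (\<Prod>a\<in>A. [:- a, 1:]) (x :: 'a::idom) = 0 \<longleftrightarrow> x \<in> A"
  by (auto simp: poly_prod)

text \<open>If d^2 divides the product, a root of d would lie in \<open>A\<close> and be a double
  root of the product, so d has no root. Each linear factor then divides the cofactor of d and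
  cancels, until d divides 1.\<close>

lemma squarefree_prod_linear:
  fixes A :: "'a::field set"
  assumes "finite A"
  shows "squarefree (\<Prod>a\<in>A. [:- a, 1:])"
proof (rule squarefreeI)
  fix d :: "'a poly" assume d: "d ^ 2 dvd (\<Prod>a\<in>A. [:- a, 1:])"
  have nz: "(\<Prod>a\<in>A. [:- a, 1:]) \<noteq> 0"
    using assms by simp
  have noroot: "poly d x \<noteq> 0" for x
  proof
    assume x: "poly d x = 0"
    have xA: "x \<in> A"
      using d x assms poly_prod_linear_eq_0_iff[of A x] by (auto elim!: dvdE simp: power2_eq_square)
    have "[:- x, 1:] ^ 2 dvd d ^ 2"
      using x by (simp add: poly_eq_0_iff_dvd dvd_power_same)
    then have "[:- x, 1:] ^ 2 dvd [:- x, 1:] * (\<Prod>a\<in>A - {x}. [:- a, 1:])"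
      using dvd_trans[OF _ d] prod.remove[OF assms xA, of "\<lambda>a. [:- a, 1:]"] by metis
    then have "[:- x, 1:] dvd (\<Prod>a\<in>A - {x}. [:- a, 1:])"
      unfolding power2_eq_square by (subst (asm) dvd_mult_cancel_left) simp
    then have "poly (\<Prod>a\<in>A - {x}. [:- a, 1:]) x = 0"
      by (simp add: poly_eq_0_iff_dvd)
    then show False
      using assms poly_prod_linear_eq_0_iff[of "A - {x}" x] by simp
  qed
  have dvd: "d dvd (\<Prod>a\<in>A. [:- a, 1:])"
    using d by (simp add: power2_eq_square dvd_mult_left)
  have "d dvd 1" if "finite B" "d dvd (\<Prod>a\<in>B. [:- a, 1:])" for B
    using that
  proof (induction B rule: finite_induct)
    case (insert a B)
    then obtain e where e: "[:- a, 1:] * (\<Prod>a\<in>B. [:- a, 1:]) = d * e"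
      by (auto simp del: mult_pCons_left elim!: dvdE)
    then have "poly d a * poly e a = 0"
      unfolding poly_mult[symmetric] e[symmetric] by (simp only: poly_mult) simp
    then have "[:- a, 1:] dvd e"
      using noroot[of a] by (simp add: poly_eq_0_iff_dvd)
    then obtain e' where "e = [:- a, 1:] * e'"
      by (elim dvdE)
    with e have e': "[:- a, 1:] * (\<Prod>a\<in>B. [:- a, 1:]) = [:- a, 1:] * (d * e')"
      by (simp only: mult.left_commute)
    then have "(\<Prod>a\<in>B. [:- a, 1:]) = d * e'"
      by (subst (asm) mult_cancel_left) simp
    then show ?case
      using insert.IH by simp
  qed simp
  with dvd assms show "d dvd 1"
    by blast
qed

section \<open>Cyclotomic polynomials\<close>

text \<open>Division by a monic integer polynomial stays in the integers, and the complex quotient is unique.\<close>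
lemma monic_int_quotient:
  fixes p q :: "int poly" and r :: "complex poly"
  assumes q: "Polynomial.lead_coeff q = 1" and eq: "map_poly of_int p = map_poly of_int q * r"
  shows "\<exists>s. r = map_poly of_int s"
proof -
  interpret I: ring_morphism "of_int :: int \<Rightarrow> complex" by (rule of_int_morphism)
  interpret M: ring_morphism "map_poly (of_int :: int \<Rightarrow> complex)"
    by (rule I.map_poly_morphism)
  obtain s t where st: "pseudo_divmod p q = (s, t)" by fastforce
  have q0: "q \<noteq> 0" using q by auto
  have p: "p = q * s + t" and t: "t = 0 \<or> Polynomial.degree t < Polynomial.degree q"
    using pseudo_divmod[OF q0 st] q by simp_all
  have "map_poly of_int t = map_poly of_int q * (r - map_poly of_int s)"
    using eq by (simp add: p M.hom_add M.hom_mult algebra_simps)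
  moreover have deg: "Polynomial.degree (map_poly of_int u :: complex poly) = Polynomial.degree u"
    for u :: "int poly"
    by (rule degree_map_poly) auto
  ultimately have "r - map_poly of_int s = 0"
    using t deg[of t] deg[of q] q0
    by (metis (no_types, lifting) M.hom_zero add_leD1 degree_mult_eq leD le_add1 map_poly_of_int_eq_iff
        mult_eq_0_iff)
  then show ?thesis by auto
qed

definition complex_cyclotomic :: "nat \<Rightarrow> complex poly"
  where "complex_cyclotomic n = (\<Prod>k\<in>totatives n. [:- cis (2 * pi * real k / real n), 1:])"

lemma degree_complex_cyclotomic: "Polynomial.degree (complex_cyclotomic n) = totient n"
  unfolding complex_cyclotomic_def by (subst degree_prod_sum_eq) (auto simp: totient_def)

lemma monic_complex_cyclotomic: "Polynomial.lead_coeff (complex_cyclotomic n) = 1"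
  unfolding complex_cyclotomic_def by (simp add: lead_coeff_prod)

lemma degree_monom_minus_1:
  "n > 0 \<Longrightarrow> Polynomial.degree (Polynomial.monom 1 n - 1 :: 'a::comm_ring_1 poly) = n"
  by (subst diff_conv_add_uminus, subst degree_add_eq_left) (auto simp: degree_monom_eq)

lemma monic_monom_minus_1:
  "n > 0 \<Longrightarrow> Polynomial.lead_coeff (Polynomial.monom 1 n - 1 :: 'a::comm_ring_1 poly) = 1"
  using degree_monom_minus_1[of n, where ?'a = 'a] by simp

lemma prod_cis_linear:
  assumes "n > 0"
  shows "(\<Prod>k\<in>{0<..n}. [:- cis (2 * pi * real k / real n), 1:]) = Polynomial.monom 1 n - 1"
proof -
  define f where "f = (\<lambda>k. cis (2 * pi * real k / real n))"
  have bij: "bij_betw f {..<n} {z. z ^ n = 1}"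
    unfolding f_def by (rule bij_betw_roots_unity[OF assms])
  have fn: "f n = f 0" using assms by (simp add: f_def)
  \<comment> \<open>Totatives of n lie in {0<..n}, the roots of unity are indexed by {..<n}; the
    indices n and 0 both give the root 1.\<close>
  have "(\<Prod>k\<in>{0<..n}. [:- f k, 1:]) = (\<Prod>k\<in>{..<n}. [:- f k, 1:])"
    by (rule prod.reindex_bij_witness[of _ "\<lambda>k. if k = 0 then n else k" "\<lambda>k. if k = n then 0 else k"])
       (use assms fn in auto)
  also have "\<dots> = (\<Prod>z\<in>{z. z ^ n = 1}. [:- z, 1:])"
    by (rule prod.reindex_bij_betw[OF bij])
  also have "\<dots> = Polynomial.monom 1 n - 1"
    by (rule monic_eq_prod_roots[symmetric])
       (use assms card_roots_unity_eq[of n] in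
         \<open>auto simp: monic_monom_minus_1 degree_monom_minus_1 poly_monom finite_roots_unity\<close>)
  finally show ?thesis by (simp add: f_def)
qed

text \<open>Sort the indices by d = gcd k n: those with gcd d are d times the totatives of n div d,
  and the angle depends only on k / n, so together they contribute the polynomial of index n div
  d.\<close>

lemma prod_complex_cyclotomic:
  assumes "n > 0"
  shows "(\<Prod>d | d dvd n. complex_cyclotomic d) = Polynomial.monom 1 n - 1"
proof -
  define g where "g = (\<lambda>k m. [:- cis (2 * pi * real k / real m), 1:])"
  define A where "A = (\<lambda>d. {k\<in>{0<..n}. gcd k n = d})"
  have "Polynomial.monom 1 n - 1 = (\<Prod>k\<in>{0<..n}. g k n)"
    unfolding g_def by (rule prod_cis_linear[OF assms, symmetric])
  also have "{0<..n} = (\<Union>d\<in>{d. d dvd n}. A d)" by (auto simp: A_def)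
  also have "(\<Prod>k\<in>\<dots>. g k n) = (\<Prod>d | d dvd n. \<Prod>k\<in>A d. g k n)"
    using assms by (intro prod.UNION_disjoint) (auto simp: A_def)
  also have "\<dots> = (\<Prod>d | d dvd n. complex_cyclotomic (n div d))"
  proof (intro prod.cong refl)
    fix d assume "d \<in> {d. d dvd n}"
    then have d: "d dvd n" by simp
    have "(\<Prod>k\<in>A d. g k n) = (\<Prod>k\<in>totatives (n div d). g (k * d) n)"
      unfolding A_def by (rule prod.reindex_bij_betw[OF bij_betw_totatives_gcd_eq[OF d assms], symmetric])
    also have "\<dots> = complex_cyclotomic (n div d)"
      unfolding complex_cyclotomic_def g_def using d assms
      by (intro prod.cong refl) (auto elim!: dvdE simp: field_simps)
    finally show "(\<Prod>k\<in>A d. g k n) = complex_cyclotomic (n div d)" .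
  qed
  also have "\<dots> = (\<Prod>d | d dvd n. complex_cyclotomic d)"
    using assms by (intro prod.reindex_bij_witness[of _ "(div) n" "(div) n"]) (auto elim: dvdE)
  finally show ?thesis ..
qed

text \<open>By strong induction the product over the proper divisors is monic with integer
  coefficients, and \<Phi>_n is the complex quotient of X^n - 1 by it.\<close>

lemma ex_int_cyclotomic:
  assumes "n > 0"
  shows "\<exists>p. map_poly of_int p = complex_cyclotomic n"
  using assms
proof (induction n rule: less_induct)
  case (less n)
  interpret I: ring_morphism "of_int :: int \<Rightarrow> complex" by (rule of_int_morphism)
  interpret M: ring_morphism "map_poly (of_int :: int \<Rightarrow> complex)"
    by (rule I.map_poly_morphism)
  have "\<exists>p. map_poly of_int p = complex_cyclotomic d" if "d dvd n" "d \<noteq> n" for d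
    using less that by (metis dvd_imp_le dvd_pos_nat le_neq_implies_less)
  then obtain F where F: "\<And>d. d dvd n \<Longrightarrow> d \<noteq> n \<Longrightarrow> map_poly of_int (F d) = complex_cyclotomic d"
    by metis
  define q where "q = (\<Prod>d\<in>{d. d dvd n} - {n}. F d)"
  have q: "map_poly of_int q = (\<Prod>d\<in>{d. d dvd n} - {n}. complex_cyclotomic d)"
    unfolding q_def M.hom_prod by (intro prod.cong) (auto simp: F)
  have "Polynomial.lead_coeff (map_poly of_int q :: complex poly) = 1"
    unfolding q lead_coeff_prod by (simp add: monic_complex_cyclotomic)
  then have lc: "Polynomial.lead_coeff q = 1"
    by (subst (asm) degree_map_poly) (auto simp: I.coeff_map)
  have "map_poly of_int (Polynomial.monom 1 n - 1 :: int poly) = (Polynomial.monom 1 n - 1 :: complex poly)"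
    by (simp add: M.hom_diff M.hom_one map_poly_monom)
  also have "\<dots> = map_poly of_int q * complex_cyclotomic n"
    using less.prems prod_complex_cyclotomic[of n]
      prod.remove[of "{d. d dvd n}" n complex_cyclotomic]
    by (simp add: q mult.commute)
  finally show ?case
    using monic_int_quotient[OF lc] by metis
qed

lemma map_poly_int_cyclotomic:
  assumes "n > 0"
  shows "map_poly of_int (int_cyclotomic n) = complex_cyclotomic n"
proof -
  have "\<exists>!p. map_poly (of_int :: int \<Rightarrow> complex) p = complex_cyclotomic n"
    using ex_int_cyclotomic[OF assms] map_poly_of_int_eq_iff[where ?'a = complex] by metis
  then show ?thesis
    unfolding int_cyclotomic_def complex_cyclotomic_def[symmetric] by (rule theI')
qed

lemma degree_int_cyclotomic: "n > 0 \<Longrightarrow> Polynomial.degree (int_cyclotomic n) = totient n"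
  using degree_map_poly[of "of_int :: int \<Rightarrow> complex" "int_cyclotomic n"]
  by (simp add: map_poly_int_cyclotomic degree_complex_cyclotomic)

lemma monic_int_cyclotomic:
  assumes "n > 0"
  shows "Polynomial.lead_coeff (int_cyclotomic n) = 1"
proof -
  have "Polynomial.coeff (map_poly of_int (int_cyclotomic n)) (totient n) = (1 :: complex)"
    unfolding map_poly_int_cyclotomic[OF assms]
    using monic_complex_cyclotomic[of n] by (simp add: degree_complex_cyclotomic)
  then show ?thesis
    by (simp add: degree_int_cyclotomic[OF assms] coeff_map_poly)
qed

text \<open>This replaces the description by complex roots: palindromicity and, after
  \<open>of_int\<close>, the roots in characteristic p are both derived from it.\<close>

lemma prod_int_cyclotomic:
  assumes "n > 0"
  shows "(\<Prod>d | d dvd n. int_cyclotomic d) = Polynomial.monom 1 n - 1"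
proof -
  interpret I: ring_morphism "of_int :: int \<Rightarrow> complex" by (rule of_int_morphism)
  interpret M: ring_morphism "map_poly (of_int :: int \<Rightarrow> complex)"
    by (rule I.map_poly_morphism)
  have "map_poly of_int (\<Prod>d | d dvd n. int_cyclotomic d) = (\<Prod>d | d dvd n. complex_cyclotomic d)"
    unfolding M.hom_prod
    by (intro prod.cong refl map_poly_int_cyclotomic) (use assms in \<open>auto intro: Nat.gr0I\<close>)
  also have "\<dots> = map_poly of_int (Polynomial.monom 1 n - 1)"
    by (simp add: prod_complex_cyclotomic[OF assms] M.hom_diff M.hom_one map_poly_monom)
  finally show ?thesis
    by (simp only: map_poly_of_int_eq_iff)
qed

lemma reflect_poly_prod:
  "reflect_poly (prod f A) = (\<Prod>x\<in>A. reflect_poly (f x :: 'a::idom poly))"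
  by (induction A rule: infinite_finite_induct) (auto simp: reflect_poly_mult)

lemma reflect_monom_minus_1:
  assumes "n > 0"
  shows "reflect_poly (Polynomial.monom 1 n - 1 :: 'a::idom poly) = - (Polynomial.monom 1 n - 1)"
  by (rule poly_eqI) (use assms in \<open>auto simp: coeff_reflect_poly degree_monom_minus_1\<close>)

lemma int_cyclotomic_1: "int_cyclotomic (Suc 0) = Polynomial.monom 1 (Suc 0) - 1"
  using prod_int_cyclotomic[of 1] by simp

lemma reflect_int_cyclotomic:
  assumes "n \<ge> 2"
  shows "reflect_poly (int_cyclotomic n) = int_cyclotomic n"
  using assms
proof (induction n rule: less_induct)
  case (less n)
  define D where "D = {d. d dvd n} - {n} - {1}"
  define Q where "Q = (\<Prod>d\<in>D. int_cyclotomic d)"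
  have split: "(\<Prod>d | d dvd n. f d) = f n * (f (Suc 0) * (\<Prod>d\<in>D. f d))" for f :: "nat \<Rightarrow> int poly"
    using less.prems unfolding D_def
    by (subst prod.remove[of _ n], simp, simp, subst prod.remove[of _ 1]) simp_all
  have Q: "reflect_poly Q = Q"
    unfolding Q_def reflect_poly_prod
  proof (intro prod.cong refl less.IH)
    fix d assume "d \<in> D"
    then have "d dvd n" "d \<noteq> n" "d \<noteq> 1" by (auto simp: D_def)
    moreover have "d > 0" using \<open>d dvd n\<close> less.prems by (intro Nat.gr0I) auto
    ultimately show "d < n" "2 \<le> d" using less.prems dvd_imp_le[of d n] by auto
  qed
  \<comment> \<open>Reflecting \<open>X^n - 1\<close> changes its sign, and so does reflecting the factor \<open>X - 1\<close>; all
      other proper factors are fixed by induction.\<close>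
  have p: "int_cyclotomic n * (int_cyclotomic (Suc 0) * Q) = Polynomial.monom 1 n - 1"
    using split[of int_cyclotomic] prod_int_cyclotomic[of n] less.prems by (simp add: Q_def)
  have "reflect_poly (int_cyclotomic n) * (reflect_poly (int_cyclotomic (Suc 0)) * reflect_poly Q)
      = - (Polynomial.monom 1 n - 1)"
    using arg_cong[OF p, of reflect_poly] less.prems
    by (simp only: reflect_poly_mult reflect_monom_minus_1)
  also have "reflect_poly (int_cyclotomic (Suc 0)) = - int_cyclotomic (Suc 0)"
    unfolding int_cyclotomic_1 by (rule reflect_monom_minus_1) simp
  finally have "reflect_poly (int_cyclotomic n) * (int_cyclotomic (Suc 0) * Q)
      = int_cyclotomic n * (int_cyclotomic (Suc 0) * Q)"
    by (simp add: Q p)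
  moreover have "int_cyclotomic (Suc 0) * Q \<noteq> 0"
    using p monic_monom_minus_1[of n, where ?'a = int] less.prems by auto
  ultimately show ?case by simp
qed

lemma coeff_int_cyclotomic_palindromic:
  assumes "n \<ge> 2" "i \<le> totient n"
  shows "Polynomial.coeff (int_cyclotomic n) (totient n - i) = Polynomial.coeff (int_cyclotomic n) i"
proof -
  have "Polynomial.coeff (reflect_poly (int_cyclotomic n)) i
      = Polynomial.coeff (int_cyclotomic n) (totient n - i)"
    using assms degree_int_cyclotomic[of n] by (simp add: coeff_reflect_poly)
  then show ?thesis
    by (simp add: reflect_int_cyclotomic[OF assms(1)])
qed

lemma coeff_cyclotomic:
  "Polynomial.coeff (cyclotomic n :: 'a::comm_ring_1 poly) i = of_int (Polynomial.coeff (int_cyclotomic n) i)"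
  by (simp add: cyclotomic_def coeff_map_poly)

text \<open>Mapping by \<open>of_int\<close> may kill coefficients, but not the leading coefficient
  1.\<close>

lemma degree_cyclotomic:
  assumes "n > 0"
  shows "Polynomial.degree (cyclotomic n :: 'a::comm_ring_1 poly) = totient n"
proof (rule antisym)
  show "Polynomial.degree (cyclotomic n :: 'a poly) \<le> totient n"
    by (rule degree_le) (use degree_int_cyclotomic[OF assms] in \<open>auto simp: coeff_cyclotomic coeff_eq_0\<close>)
  show "totient n \<le> Polynomial.degree (cyclotomic n :: 'a poly)"
    by (rule le_degree)
       (use monic_int_cyclotomic[OF assms] in \<open>simp add: coeff_cyclotomic degree_int_cyclotomic assms\<close>)
qed

lemma monic_cyclotomic:
  "n > 0 \<Longrightarrow> Polynomial.lead_coeff (cyclotomic n :: 'a::comm_ring_1 poly) = 1"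
  using monic_int_cyclotomic[of n]
  by (simp add: degree_cyclotomic coeff_cyclotomic degree_int_cyclotomic)

lemma prod_cyclotomic:
  assumes "n > 0"
  shows "(\<Prod>d | d dvd n. cyclotomic d) = (Polynomial.monom 1 n - 1 :: 'a::comm_ring_1 poly)"
proof -
  interpret I: ring_morphism "of_int :: int \<Rightarrow> 'a" by (rule of_int_morphism)
  interpret M: ring_morphism "map_poly (of_int :: int \<Rightarrow> 'a)"
    by (rule I.map_poly_morphism)
  show ?thesis
    using arg_cong[OF prod_int_cyclotomic[OF assms], of "map_poly (of_int :: int \<Rightarrow> 'a)"]
    by (simp add: M.hom_prod M.hom_diff M.hom_one map_poly_monom cyclotomic_def)
qed

section \<open>Roots of unity\<close>

text \<open>The polynomial splits over its multiset of roots; a root of multiplicity at least two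
  would also be a root of \<open>pderiv p\<close>, so the multiset has no repetitions.\<close>

lemma card_roots_eq_degree:
  fixes p :: "'a::alg_closed_field poly"
  assumes p: "p \<noteq> 0" and simple: "\<And>x. poly p x = 0 \<Longrightarrow> poly (pderiv p) x \<noteq> 0"
  shows "card {x. poly p x = 0} = Polynomial.degree p"
proof -
  obtain A where A: "size A = Polynomial.degree p"
    and eq: "p = Polynomial.smult (Polynomial.lead_coeff p) (\<Prod>x\<in>#A. [:- x, 1:])"
    using alg_closed_imp_factorization[OF p] by blast
  have roots: "{x. poly p x = 0} = set_mset A"
    using p by (subst eq) (auto simp: poly_prod_mset prod_mset_zero_iff)
  have "count A x = 1" if "x \<in># A" for x
  proof (rule ccontr)
    assume "count A x \<noteq> 1"
    with that have "count A x \<ge> 2"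
      using count_greater_zero_iff[of A x] by linarith
    then have "{#x, x#} \<subseteq># A"
      by (auto simp: subseteq_mset_def)
    then obtain B where "A = {#x, x#} + B"
      by (metis subset_mset.add_diff_inverse)
    then obtain r where r: "p = [:- x, 1:] * ([:- x, 1:] * r)"
      using eq by (metis (no_types, lifting) image_mset_add_mset add_mset_add_single
          image_mset_union mult.assoc mult_smult_right prod_mset.add_mset prod_mset.union
          add_mset_commute union_mset_add_mset_left add_0)
    have "poly p x = 0" "poly (pderiv p) x = 0"
      by (simp_all add: r pderiv_mult del: mult_pCons_left)
    then show False using simple by blast
  qed
  then have "size A = card (set_mset A)"
    unfolding size_multiset_overloaded_eq by simp
  then show ?thesis
    using A roots by simp
qed

text \<open>The derivative n z^(n-1) vanishes at no root, since n is invertible and c is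
  nonzero.\<close>

lemma card_nth_roots:
  fixes c :: "'a::alg_closed_field"
  assumes n: "of_nat n \<noteq> (0 :: 'a)" and c: "c \<noteq> 0"
  shows "card {z. z ^ n = c} = n"
proof -
  have n0: "n > 0" using n by (cases n) auto
  define p where "p = Polynomial.monom 1 n - [:c:]"
  have deg: "Polynomial.degree p = n"
    unfolding p_def diff_conv_add_uminus using n0
    by (subst degree_add_eq_left) (auto simp: degree_monom_eq)
  have p0: "p \<noteq> 0" using deg n0 by auto
  have root: "poly p z = 0 \<longleftrightarrow> z ^ n = c" for z
    by (simp add: p_def poly_monom)
  have "poly (pderiv p) z \<noteq> 0" if "poly p z = 0" for z
  proof -
    have "z \<noteq> 0" using that c n0 by (auto simp: root)
    then show ?thesis
      using n by (simp add: p_def pderiv_diff pderiv_monom poly_monom pderiv_pCons)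
  qed
  then show ?thesis
    using card_roots_eq_degree[OF p0] by (simp add: root deg)
qed

text \<open>For n > 0 these are the elements of multiplicative order exactly n; one equivalence
  yields both z^n = 1 and the minimality of n.\<close>

definition primitive_roots :: "nat \<Rightarrow> 'a::field set"
  where "primitive_roots n = {z. \<forall>m. z ^ m = 1 \<longleftrightarrow> n dvd m}"

lemma ex_primitive_roots:
  fixes z :: "'a::field"
  assumes "z ^ n = 1" "n > 0"
  shows "\<exists>d. d dvd n \<and> z \<in> primitive_roots d"
proof -
  define d where "d = (LEAST m. m > 0 \<and> z ^ m = 1)"
  have d: "d > 0" "z ^ d = 1"
    using LeastI[of "\<lambda>m. m > 0 \<and> z ^ m = 1" n] assms by (auto simp: d_def)
  have "z ^ m = 1 \<longleftrightarrow> d dvd m" for m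
  proof
    assume m: "z ^ m = 1"
    have "z ^ m = (z ^ d) ^ (m div d) * z ^ (m mod d)"
      by (simp flip: power_mult power_add)
    then have "z ^ (m mod d) = 1"
      using m d by simp
    then have "\<not> 0 < m mod d"
      using not_less_Least[of "m mod d" "\<lambda>m. m > 0 \<and> z ^ m = 1"] d by (auto simp: d_def[symmetric])
    then show "d dvd m" by (simp add: dvd_eq_mod_eq_0)
  qed (auto simp: power_mult d)
  then show ?thesis
    using assms by (auto simp: primitive_roots_def)
qed

text \<open>\<open>X^n - 1 = \<Phi>\<^sub>n R\<close> has derivative \<open>\<Phi>\<^sub>n'(z) R(z)\<close> at a root \<open>z\<close> of \<open>\<Phi>\<^sub>n\<close>, and it is nonzero.\<close>
lemma cyclotomic_roots_simple:
  fixes z :: "'a::field"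
  assumes n: "of_nat n \<noteq> (0 :: 'a)" and z: "poly (cyclotomic n) z = 0"
  shows "z ^ n = 1" "poly (pderiv (cyclotomic n)) z \<noteq> 0"
    "\<And>d. d dvd n \<Longrightarrow> d \<noteq> n \<Longrightarrow> poly (cyclotomic d) z \<noteq> 0"
proof -
  have n0: "n > 0" using n by (cases n) auto
  define R :: "'a poly" where "R = (\<Prod>d\<in>{d. d dvd n} - {n}. cyclotomic d)"
  have R: "Polynomial.monom 1 n - 1 = cyclotomic n * R"
    using prod.remove[of "{d. d dvd n}" n "cyclotomic :: nat \<Rightarrow> 'a poly"] prod_cyclotomic[OF n0, where ?'a = 'a]
      n0 by (simp add: R_def)
  show zn: "z ^ n = 1"
    using arg_cong[OF R, of "\<lambda>p. poly p z"] z by (simp add: poly_monom)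
  have "z \<noteq> 0" using zn n0 by (cases n) auto
  then have "poly (pderiv (Polynomial.monom 1 n - 1)) z \<noteq> 0"
    using n by (simp add: pderiv_diff pderiv_monom poly_monom)
  then have "poly (pderiv (cyclotomic n)) z * poly R z \<noteq> 0"
    by (simp add: R pderiv_mult z mult.commute)
  then show "poly (pderiv (cyclotomic n)) z \<noteq> 0"
    "\<And>d. d dvd n \<Longrightarrow> d \<noteq> n \<Longrightarrow> poly (cyclotomic d) z \<noteq> 0"
    using n0 by (auto simp: R_def poly_prod)
qed

text \<open>An element of order d is a root of X^d - 1, hence of some \<Phi>_e with e | d, and z^e =
  1 forces e = d. Conversely, a root of \<Phi>_n of order d < n would be a common root of \<Phi>_d
  and \<Phi>_n, hence a multiple root of X^n - 1.\<close>

lemma poly_cyclotomic_eq_0_iff: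
  fixes z :: "'a::field"
  assumes n: "of_nat n \<noteq> (0 :: 'a)"
  shows "poly (cyclotomic n) z = 0 \<longleftrightarrow> z \<in> primitive_roots n"
proof -
  have n0: "n > 0" using n by (cases n) auto
  have 1: "poly (cyclotomic d) z = 0" if z: "z \<in> primitive_roots d" and d: "of_nat d \<noteq> (0 :: 'a)" for d
  proof -
    have d0: "d > 0" using d by (cases d) auto
    have "z ^ d = 1" using z by (auto simp: primitive_roots_def)
    then have "poly (\<Prod>e | e dvd d. cyclotomic e) z = 0"
      by (simp add: prod_cyclotomic[OF d0] poly_monom)
    then obtain e where e: "e dvd d" "poly (cyclotomic e) z = 0"
      using d0 by (auto simp: poly_prod)
    have "of_nat e \<noteq> (0 :: 'a)" using d e(1) by (auto elim!: dvdE)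
    then have "z ^ e = 1" using cyclotomic_roots_simple(1)[of e z] e by simp
    then have "e = d" using z e(1) by (auto simp: primitive_roots_def intro: dvd_antisym)
    then show ?thesis using e by simp
  qed
  show ?thesis
  proof
    assume z: "poly (cyclotomic n) z = 0"
    obtain d where d: "d dvd n" "z \<in> primitive_roots d"
      using ex_primitive_roots[OF cyclotomic_roots_simple(1)[OF n z] n0] by blast
    have "of_nat d \<noteq> (0 :: 'a)" using d(1) n by (auto elim!: dvdE)
    then have "poly (cyclotomic d) z = 0" using 1 d(2) by blast
    then have "d = n" using cyclotomic_roots_simple(3)[OF n z] d(1) by blast
    then show "z \<in> primitive_roots n" using d by simp
  qed (rule 1[OF _ n])
qed

lemma card_primitive_roots:
  assumes n: "of_nat n \<noteq> (0 :: 'a::alg_closed_field)"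
  shows "card (primitive_roots n :: 'a set) = totient n"
proof -
  have n0: "n > 0" using n by (cases n) auto
  have "cyclotomic n \<noteq> (0 :: 'a poly)"
    using monic_cyclotomic[OF n0, where ?'a = 'a] by auto
  from card_roots_eq_degree[OF this] show ?thesis
    using cyclotomic_roots_simple(2)[OF n] by (simp add: poly_cyclotomic_eq_0_iff[OF n] degree_cyclotomic[OF n0])
qed

section \<open>Lucas polynomials and Lucas atoms\<close>

text \<open>The power sums satisfy the recursion of \<open>lucas_V\<close>. The morphism is left
  arbitrary so that a, b can be the generic roots as well as the roots of a specialised
  quadratic.\<close>

lemma lucas_V_morphism:
  assumes "ring_morphism h" and B: "h indet_B = - (a + b)" and C: "h indet_C = a * b"
  shows "h (lucas_V n) = a ^ n + b ^ n"
proof -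
  interpret ring_morphism h by fact
  have 2: "h 2 = 2" using hom_of_nat[of 2] by simp
  show ?thesis
    by (induction n rule: lucas_V.induct)
       (simp_all add: 2 hom_uminus hom_diff hom_mult B C algebra_simps)
qed

text \<open>Pairing the terms \<open>i\<close> and \<open>\<phi>(n) - i\<close> of the palindromic polynomial \<open>\<Phi>\<^sub>n\<close>, and using
  \<open>\<alpha>^i \<beta>^(\<phi>(n)-i) + \<alpha>^(\<phi>(n)-i) \<beta>^i = C^i V\<^sub>j\<close> with \<open>j = \<phi>(n) - 2i\<close>.\<close>
definition lucas_atom_expansion :: "nat \<Rightarrow> 'a::comm_ring_1 poly poly"
  where "lucas_atom_expansion n =
    of_int (Polynomial.coeff (int_cyclotomic n) (totient n div 2)) * indet_C ^ (totient n div 2) +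
    (\<Sum>i<totient n div 2. of_int (Polynomial.coeff (int_cyclotomic n) i) * indet_C ^ i * lucas_V (totient n - 2 * i))"

lemma sum_atMost_double:
  fixes f :: "nat \<Rightarrow> 'a::comm_monoid_add"
  shows "(\<Sum>i\<le>2 * m. f i) = f m + (\<Sum>i<m. f i + f (2 * m - i))"
proof -
  have "{..2 * m} = insert m ({..<m} \<union> {m<..2 * m})" by auto
  then have "(\<Sum>i\<le>2 * m. f i) = f m + ((\<Sum>i<m. f i) + (\<Sum>i\<in>{m<..2 * m}. f i))"
    by (simp, subst sum.union_disjoint) auto
  also have "(\<Sum>i\<in>{m<..2 * m}. f i) = (\<Sum>i<m. f (2 * m - i))"
    by (rule sum.reindex_bij_witness[of _ "\<lambda>i. 2 * m - i" "\<lambda>i. 2 * m - i"]) auto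
  finally show ?thesis by (simp add: sum.distrib)
qed

text \<open>For n > 2 the degree \<open>totient n\<close> is even, so the coefficients pair off
  around a middle term; \<open>b \<noteq> 0\<close> allows the homogenisation to be multiplied
  out.\<close>

lemma lucas_atom_expansion_morphism:
  fixes h :: "'a::comm_ring_1 poly poly \<Rightarrow> 'k::field"
  assumes n: "n > 2" and "ring_morphism h"
    and B: "h indet_B = - (a + b)" and C: "h indet_C = a * b" and b: "b \<noteq> 0"
  shows "h (lucas_atom_expansion n) = cyclotomic_hom n a b"
proof -
  interpret ring_morphism h by fact
  define c where "c = (\<lambda>i. of_int (Polynomial.coeff (int_cyclotomic n) i) :: 'k)"
  obtain m where m: "totient n = 2 * m" using totient_even[OF n] by (elim evenE)
  have deg: "Polynomial.degree (cyclotomic n :: 'k poly) = 2 * m"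
    using degree_cyclotomic[of n] n m by simp
  have "cyclotomic_hom n a b = (\<Sum>i\<le>2 * m. b ^ (2 * m) * (c i * (a / b) ^ i))"
    unfolding cyclotomic_hom_def poly_altdef deg m coeff_cyclotomic c_def sum_distrib_left ..
  also have "\<dots> = (\<Sum>i\<le>2 * m. c i * a ^ i * b ^ (2 * m - i))"
    by (intro sum.cong refl) (use b in \<open>simp add: power_divide power_diff\<close>)
  also have "\<dots> = c m * a ^ m * b ^ m +
      (\<Sum>i<m. c i * a ^ i * b ^ (2 * m - i) + c (2 * m - i) * a ^ (2 * m - i) * b ^ (2 * m - (2 * m - i)))"
    unfolding sum_atMost_double by (simp add: mult_2)
  also have "\<dots> = c m * (a * b) ^ m + (\<Sum>i<m. c i * (a * b) ^ i * (a ^ (2 * m - 2 * i) + b ^ (2 * m - 2 * i)))"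
  proof -
    have "c i * a ^ i * b ^ (2 * m - i) + c (2 * m - i) * a ^ (2 * m - i) * b ^ (2 * m - (2 * m - i))
        = c i * (a * b) ^ i * (a ^ (2 * m - 2 * i) + b ^ (2 * m - 2 * i))" if i: "i < m" for i
    proof -
      have "c (2 * m - i) = c i"
        using coeff_int_cyclotomic_palindromic[of n i] n m i by (simp add: c_def)
      \<comment> \<open>With m = i + j the exponents 2m - i and 2m - 2i become i + 2j and 2j, free
        of truncated subtraction.\<close>
      moreover obtain j where "m = i + j" using i less_imp_add_positive by blast
      moreover have "2 * (i + j) - i = i + 2 * j" "2 * (i + j) - 2 * i = 2 * j"
        "2 * (i + j) - (i + 2 * j) = i" by simp_all
      ultimately show ?thesis
        by (simp add: power_add power_mult_distrib algebra_simps)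
    qed
    then show ?thesis by (simp add: power_mult_distrib)
  qed
  also have "\<dots> = h (lucas_atom_expansion n)"
    unfolding lucas_atom_expansion_def m
    by (simp add: hom_add hom_mult hom_sum hom_of_int hom_power C c_def
        lucas_V_morphism[OF assms(2) B C])
  finally show ?thesis ..
qed

text \<open>The expansion meets the description by the preceding lemma for
  \<open>to_closure\<close>, and injectivity of \<open>to_closure\<close> makes it the only such
  polynomial.\<close>

lemma lucas_atom_eq_expansion:
  assumes n: "n > 2"
  shows "lucas_atom n = (lucas_atom_expansion n :: 'a::field poly poly)"
proof -
  define B :: "'a poly poly fract alg_closure" where "B = to_closure indet_B"
  define C :: "'a poly poly fract alg_closure" where "C = to_closure indet_C"
  have C0: "C \<noteq> 0" by (simp add: C_def to_closure_def indet_C_def)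
  have roots: "B = - (\<alpha> + \<beta>)" "C = \<alpha> * \<beta>" "\<beta> \<noteq> 0"
    if "[:C, B, 1:] = [:- \<alpha>, 1:] * [:- \<beta>, 1:]" for \<alpha> \<beta>
    using that C0 by (auto simp: algebra_simps)
  have val: "to_closure (lucas_atom_expansion n) = cyclotomic_hom n \<alpha> \<beta>"
    if "[:C, B, 1:] = [:- \<alpha>, 1:] * [:- \<beta>, 1:]" for \<alpha> \<beta>
    using roots[OF that]
    by (intro lucas_atom_expansion_morphism[OF n to_closure_morphism]) (simp_all add: B_def C_def)
  \<comment> \<open>A factorisation has to exist: otherwise the condition on L would hold vacuously
    for every L.\<close>
  obtain \<alpha> where \<alpha>: "poly [:C, B, 1:] \<alpha> = 0"
    using alg_closed_imp_poly_has_root[of "[:C, B, 1:]"] by auto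
  have ex: "[:C, B, 1:] = [:- \<alpha>, 1:] * [:- (- B - \<alpha>), 1:]"
    using \<alpha> by (auto simp: algebra_simps eq_neg_iff_add_eq_0)
  have "(THE L. \<forall>\<alpha> \<beta>. [:C, B, 1:] = [:- \<alpha>, 1:] * [:- \<beta>, 1:] \<longrightarrow> to_closure L = cyclotomic_hom n \<alpha> \<beta>)
      = lucas_atom_expansion n"
  proof (rule the_equality)
    fix L :: "'a poly poly"
    assume "\<forall>\<alpha> \<beta>. [:C, B, 1:] = [:- \<alpha>, 1:] * [:- \<beta>, 1:] \<longrightarrow> to_closure L = cyclotomic_hom n \<alpha> \<beta>"
    then have "to_closure L = to_closure (lucas_atom_expansion n)"
      using ex val by metis
    then show "L = lucas_atom_expansion n" by (simp add: to_closure_def)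
  qed (use val in blast)
  then show ?thesis
    using n by (simp add: lucas_atom_def B_def C_def)
qed

section \<open>Specialisation C = c: degree and leading coefficient in B\<close>

lemma subst_C_indet: "subst_C indet_B c = [:0, 1:]" "subst_C indet_C c = [:c:]"
  by (simp_all add: subst_C_def indet_B_def indet_C_def map_poly_pCons)

text \<open>Each step of the recursion multiplies the leading term by -B. The case n = 0 is excluded
  from the second claim because V_0 is the constant 2.\<close>

lemma subst_C_lucas_V:
  "Polynomial.degree (subst_C (lucas_V n) c) \<le> n"
  "n > 0 \<Longrightarrow> Polynomial.coeff (subst_C (lucas_V n) c) n = (- 1) ^ n"
proof -
  interpret ring_morphism "\<lambda>P. subst_C P c" by (rule subst_C_morphism)
  have 2: "subst_C 2 c = [:2:]" using hom_of_nat[of 2] by (simp add: numeral_poly)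
  have "Polynomial.degree (subst_C (lucas_V n) c) \<le> n \<and>
    (n > 0 \<longrightarrow> Polynomial.coeff (subst_C (lucas_V n) c) n = (- 1) ^ n)"
  proof (induction n rule: lucas_V.induct)
    case (3 n)
    have eq: "subst_C (lucas_V (Suc (Suc n))) c
        = - pCons 0 (subst_C (lucas_V (Suc n)) c) - Polynomial.smult c (subst_C (lucas_V n) c)"
      by (simp add: hom_diff hom_mult hom_uminus subst_C_indet)
    have "Polynomial.degree (pCons 0 (subst_C (lucas_V (Suc n)) c)) \<le> Suc (Suc n)"
      using 3 by (meson Suc_le_mono degree_pCons_le order_trans)
    moreover have "Polynomial.degree (Polynomial.smult c (subst_C (lucas_V n) c)) \<le> Suc (Suc n)"
      using 3 degree_smult_le[of c "subst_C (lucas_V n) c"] by linarith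
    ultimately have "Polynomial.degree (subst_C (lucas_V (Suc (Suc n))) c) \<le> Suc (Suc n)"
      unfolding eq by (intro degree_diff_le) (auto split: if_splits simp del: lucas_V.simps)
    moreover have "Polynomial.coeff (subst_C (lucas_V n) c) (Suc (Suc n)) = 0"
      using 3 by (intro coeff_eq_0) linarith
    ultimately show ?case
      using 3 by (simp add: eq del: lucas_V.simps)
  qed (auto simp: 2 hom_uminus subst_C_indet)
  then show "Polynomial.degree (subst_C (lucas_V n) c) \<le> n"
    "n > 0 \<Longrightarrow> Polynomial.coeff (subst_C (lucas_V n) c) n = (- 1) ^ n"
    by blast+
qed

text \<open>Only the summand i = 0 reaches degree \<open>totient n\<close>, and its Lucas polynomial
  has leading coefficient 1 because its index is even.\<close>

lemma subst_C_lucas_atom: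
  fixes c :: "'a::field"
  assumes n: "n > 2"
  shows "Polynomial.degree (subst_C (lucas_atom n) c) = totient n"
    and "Polynomial.lead_coeff (subst_C (lucas_atom n) c) = 1"
proof -
  interpret ring_morphism "\<lambda>P. subst_C P c" by (rule subst_C_morphism)
  obtain m where m: "totient n = 2 * m" using totient_even[OF n] by (elim evenE)
  have m0: "m > 0" using m n totient_gt_0_iff[of n] by linarith
  define a :: "nat \<Rightarrow> 'a" where "a = (\<lambda>i. of_int (Polynomial.coeff (int_cyclotomic n) i) * c ^ i)"
  \<comment> \<open>By palindromicity the constant coefficient of \<Phi>_n equals its leading
    coefficient.\<close>
  have a0: "a 0 = 1"
    using coeff_int_cyclotomic_palindromic[of n 0] monic_int_cyclotomic[of n] degree_int_cyclotomic[of n] n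
    by (simp add: a_def)
  have eq: "subst_C (lucas_atom n) c = [:a m:] +
      (\<Sum>i<m. Polynomial.smult (a i) (subst_C (lucas_V (2 * m - 2 * i)) c))"
    unfolding lucas_atom_eq_expansion[OF n] lucas_atom_expansion_def m
    by (simp only: hom_add hom_mult hom_sum hom_of_int hom_power subst_C_indet)
       (simp add: a_def of_int_poly poly_const_pow mult.commute)
  have "Polynomial.degree (subst_C (lucas_atom n) c) \<le> 2 * m"
    unfolding eq
  proof (intro degree_add_le degree_sum_le)
    show "Polynomial.degree (Polynomial.smult (a i) (subst_C (lucas_V (2 * m - 2 * i)) c)) \<le> 2 * m" for i
      using degree_smult_le[of "a i" "subst_C (lucas_V (2 * m - 2 * i)) c"]
        subst_C_lucas_V(1)[of "2 * m - 2 * i" c] by linarith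
  qed simp_all
  moreover have lc: "Polynomial.coeff (subst_C (lucas_atom n) c) (2 * m) = 1"
  proof -
    have "Polynomial.coeff (subst_C (lucas_atom n) c) (2 * m)
        = (\<Sum>i<m. a i * Polynomial.coeff (subst_C (lucas_V (2 * m - 2 * i)) c) (2 * m))"
      using m0 by (simp add: eq coeff_sum coeff_pCons split: nat.splits)
    also have "\<dots> = (\<Sum>i<m. if i = 0 then 1 else 0)"
    proof (intro sum.cong refl)
      fix i assume i: "i \<in> {..<m}"
      show "a i * Polynomial.coeff (subst_C (lucas_V (2 * m - 2 * i)) c) (2 * m) = (if i = 0 then 1 else 0)"
      proof (cases "i = 0")
        case False
        then have "2 * m - 2 * i < 2 * m" using i by simp
        then have "Polynomial.coeff (subst_C (lucas_V (2 * m - 2 * i)) c) (2 * m) = 0"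
          by (intro coeff_eq_0 le_less_trans[OF subst_C_lucas_V(1)])
        then show ?thesis using False by simp
      qed (use subst_C_lucas_V(2)[of "2 * m" c] m0 a0 in simp)
    qed
    finally show ?thesis using m0 by simp
  qed
  ultimately show deg: "Polynomial.degree (subst_C (lucas_atom n) c) = totient n"
    by (metis le_antisym le_degree m one_neq_zero)
  show "Polynomial.lead_coeff (subst_C (lucas_atom n) c) = 1"
    unfolding deg using lc m by simp
qed

section \<open>Generators of the unit groups\<close>

text \<open>Reducing exponents modulo m turns the integer powers in \<open>generates_units\<close>
  into finitely many natural ones.\<close>

lemma range_powi_eq:
  fixes g :: "'a::field"
  assumes g: "g ^ m = 1" and m: "m > 0"
  shows "range (\<lambda>j::int. g powi j) = (\<lambda>i. g ^ i) ` {..<m}"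
proof
  have g0: "g \<noteq> 0" using g m by (cases m) auto
  show "range (\<lambda>j::int. g powi j) \<subseteq> (\<lambda>i. g ^ i) ` {..<m}"
  proof clarify
    fix j :: int
    have "g powi j = g powi (int m * (j div int m) + j mod int m)" by simp
    also have "\<dots> = (g powi int m) powi (j div int m) * g powi (j mod int m)"
      using g0 by (simp only: power_int_add power_int_mult simp_thms)
    also have "\<dots> = g ^ nat (j mod int m)"
      using g m by (simp add: power_int_def)
    finally show "g powi j \<in> (\<lambda>i. g ^ i) ` {..<m}"
      using m by (auto simp: nat_less_iff)
  qed
  show "(\<lambda>i. g ^ i) ` {..<m} \<subseteq> range (\<lambda>j::int. g powi j)"
    by (metis image_subsetI power_int_of_nat rangeI)
qed

text \<open>An element of order d has d distinct powers, which exhaust the m-th roots of unity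
  exactly when d = m. Applied to F_q with m = q - 1 and to the field of order q^2 with m = q^2 -
  1.\<close>

lemma generates_units_iff_primitive_root:
  assumes m: "m > 0" and K: "K - {0} = {x. x ^ m = 1}" and card: "card (K - {0}) = m"
  shows "generates_units K g \<longleftrightarrow> g \<in> primitive_roots m"
proof
  assume gen: "generates_units K g"
  then have "g powi 1 \<in> {x. x ^ m = 1}"
    unfolding generates_units_def K[symmetric] by blast
  then have "g ^ m = 1" by simp
  then obtain d where d: "d dvd m" "g \<in> primitive_roots d"
    using ex_primitive_roots m by blast
  have "d > 0" using d m by (auto intro: Nat.gr0I)
  have "g ^ d = 1" using d by (simp add: primitive_roots_def)
  then have "m = card ((\<lambda>i. g ^ i) ` {..<d})"
    using gen card by (simp add: generates_units_def range_powi_eq[OF _ \<open>d > 0\<close>])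
  also have "\<dots> \<le> d"
    using card_image_le[of "{..<d}"] by simp
  finally have "d = m"
    using dvd_imp_le[OF d(1) m] by simp
  with d show "g \<in> primitive_roots m" by simp
next
  assume g: "g \<in> primitive_roots m"
  have gm: "g ^ m = 1" using g by (simp add: primitive_roots_def)
  have g0: "g \<noteq> 0" using gm m by (cases m) auto
  have "inj_on (\<lambda>i. g ^ i) {..<m}"
  proof (rule linorder_inj_onI)
    fix i j assume ij: "i < j" "i \<in> {..<m}" "j \<in> {..<m}"
    show "g ^ i \<noteq> g ^ j"
    proof
      assume "g ^ i = g ^ j"
      also have "g ^ j = g ^ i * g ^ (j - i)" using ij by (simp flip: power_add)
      finally have "g ^ (j - i) = 1" using g0 by simp
      then have "m dvd j - i" using g by (simp add: primitive_roots_def)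
      then show False using dvd_imp_le[of m "j - i"] ij by auto
    qed
  qed auto
  then have c: "card ((\<lambda>i. g ^ i) ` {..<m}) = card (K - {0})"
    using card by (simp add: card_image)
  have "(\<lambda>i. g ^ i) ` {..<m} \<subseteq> K - {0}"
  proof clarify
    fix i
    have "(g ^ i) ^ m = (g ^ m) ^ i" by (simp only: mult.commute flip: power_mult)
    then show "g ^ i \<in> K - {0}" unfolding K using gm by simp
  qed
  moreover have "finite (K - {0})"
    using card m by (intro card_ge_0_finite) simp
  ultimately have "(\<lambda>i. g ^ i) ` {..<m} = K - {0}"
    using c by (intro card_subset_eq) auto
  then show "generates_units K g"
    unfolding generates_units_def range_powi_eq[OF gm m] .
qed

section \<open>Quadratic polynomials over a finite field\<close>

text \<open>All q elements of F_q are roots of X^q - X, which has at most q roots. Membership in F_q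
  thus becomes invariance under Frobenius.\<close>

lemma range_to_ac_eq: "range (to_ac :: 'a::finite_field \<Rightarrow> _) = {x. x ^ CARD('a) = x}"
proof -
  define P :: "'a alg_closure poly" where "P = Polynomial.monom 1 CARD('a) - [:0, 1:]"
  have "card {0, 1 :: 'a} \<le> CARD('a)" by (intro card_mono) auto
  then have q: "CARD('a) > 1" by simp
  have P: "Polynomial.degree P = CARD('a)"
    unfolding P_def diff_conv_add_uminus using q
    by (subst degree_add_eq_left) (auto simp: degree_monom_eq)
  then have "P \<noteq> 0" using q by auto
  have roots: "{x. poly P x = 0} = {x. x ^ CARD('a) = x}"
    by (simp add: P_def poly_monom)
  have "range (to_ac :: 'a \<Rightarrow> _) \<subseteq> {x. x ^ CARD('a) = x}"
    by (auto simp: finite_field_power_card_eq_same simp flip: to_ac_power)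
  moreover have "finite {x. x ^ CARD('a) = (x :: 'a alg_closure)}"
    using poly_roots_finite[OF \<open>P \<noteq> 0\<close>] by (simp add: roots)
  moreover have "card {x. x ^ CARD('a) = (x :: 'a alg_closure)} \<le> card (range (to_ac :: 'a \<Rightarrow> _))"
    using card_poly_roots_bound[OF \<open>P \<noteq> 0\<close>] P by (simp add: roots card_image inj_to_ac)
  ultimately show ?thesis by (intro card_seteq)
qed

lemma irreducible_quadratic_iff:
  fixes b c :: "'a::field"
  shows "Factorial_Ring.irreducible [:c, b, 1:] \<longleftrightarrow> (\<forall>r. poly [:c, b, 1:] r \<noteq> 0)"
proof
  assume irr: "Factorial_Ring.irreducible [:c, b, 1:]"
  show "\<forall>r. poly [:c, b, 1:] r \<noteq> 0"
  proof (intro allI notI)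
    fix r assume "poly [:c, b, 1:] r = 0"
    then obtain g where g: "[:c, b, 1:] = [:- r, 1:] * g"
      by (auto simp only: poly_eq_0_iff_dvd elim!: dvdE)
    have "g \<noteq> 0" using g by auto
    then have "Polynomial.degree [:c, b, 1:] = 1 + Polynomial.degree g"
      unfolding g by (subst degree_mult_eq) auto
    then have "Polynomial.degree g = 1" by simp
    moreover have "[:- r, 1:] dvd 1 \<or> g dvd 1"
      using irr g by (blast dest: irreducibleD)
    ultimately show False
      using \<open>g \<noteq> 0\<close> by (auto simp: is_unit_iff_degree)
  qed
next
  assume noroot: "\<forall>r. poly [:c, b, 1:] r \<noteq> 0"
  show "Factorial_Ring.irreducible [:c, b, 1:]"
  proof (rule irreducibleI)
    fix g h assume gh: "[:c, b, 1:] = g * h"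
    have nz: "g \<noteq> 0" "h \<noteq> 0" using gh by auto
    have no1: "Polynomial.degree f \<noteq> 1" if f: "f dvd [:c, b, 1:]" for f
    proof
      assume "Polynomial.degree f = 1"
      then obtain u v where uv: "f = [:u, v:]" "v \<noteq> 0"
        by (cases f) (auto split: if_splits elim!: degree_eq_zeroE)
      then have "poly f (- u / v) = 0" by simp
      with f have "poly [:c, b, 1:] (- u / v) = 0"
        by (metis dvdE mult_eq_0_iff poly_mult)
      with noroot show False by blast
    qed
    have "Polynomial.degree g + Polynomial.degree h = 2"
      using arg_cong[OF gh, of Polynomial.degree] degree_mult_eq[OF nz] by simp
    moreover have "Polynomial.degree g \<noteq> 1" "Polynomial.degree h \<noteq> 1"
      using no1 gh by (metis dvd_triv_left, metis dvd_triv_right gh no1)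
    ultimately have "Polynomial.degree g = 0 \<or> Polynomial.degree h = 0" by linarith
    then show "g dvd 1 \<or> h dvd 1"
      using nz by (auto simp: is_unit_iff_degree)
  qed (auto simp: is_unit_iff_degree)
qed

lemma card_eq_card_fibres:
  assumes "finite S" and "\<And>x. x \<in> S \<Longrightarrow> card {y \<in> S. f y = f x} = m"
  shows "card S = m * card (f ` S)"
proof -
  have "card S = (\<Sum>y\<in>f ` S. card {x\<in>S. f x = y})"
    using sum.image_gen[OF assms(1), of "\<lambda>_. 1 :: nat" f] by simp
  also have "\<dots> = (\<Sum>y\<in>f ` S. m)"
    using assms(2) by (intro sum.cong) auto
  finally show ?thesis by simp
qed

text \<open>Here n is N/2, and c stays fixed, so that b is the only variable left.\<close>

locale odd_finite_field =
  fixes p k q n :: nat and c :: "'a::finite_field"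
  assumes p: "Factorial_Ring.prime p" "odd p" and q: "q = p ^ k" and card: "CARD('a) = q"
    and n: "2 * n = q + 1" and c: "primitive_element c"
begin

definition \<gamma> :: "'a alg_closure" where "\<gamma> = to_ac c"

lemma q_gt_2: "q > 2"
proof -
  have "card {0, 1 :: 'a} \<le> CARD('a)" by (intro card_mono) auto
  moreover have "odd q" using p q by simp
  ultimately show ?thesis using card by (cases "q = 2") auto
qed

lemma n_gt_1: "n > 1" using n q_gt_2 by linarith

lemma char_eq: "CHAR('a) = p"
proof -
  \<comment> \<open>Translation by 1 permutes the field, so comparing the two sums gives q = 0 in
    F_q.\<close>
  have "(\<Sum>x\<in>UNIV. x :: 'a) = (\<Sum>x\<in>UNIV. x + 1)"
    by (rule sum.reindex_bij_witness[of _ "\<lambda>x. x + 1" "\<lambda>x. x - 1"]) auto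
  then have "of_nat CARD('a) = (0 :: 'a)"
    by (simp add: sum.distrib)
  then have "CHAR('a) dvd p ^ k"
    using card q by (simp only: of_nat_eq_0_iff_char_dvd)
  moreover have "Factorial_Ring.prime CHAR('a)"
    using prime_CHAR_semidom[where ?'a = 'a] CHAR_pos[where ?'a = 'a] by simp
  ultimately show ?thesis
    using p by (metis prime_dvd_power primes_dvd_imp_eq)
qed

lemma frobenius_add: "(x + y :: 'a alg_closure) ^ q = x ^ q + y ^ q"
  by (rule freshmans_dream') (use p q char_eq in auto)

lemma frobenius_to_ac: "to_ac (u :: 'a) ^ q = to_ac u"
  using finite_field_power_card_eq_same[of u] card by (metis to_ac_power)

lemma frobenius_minus: "(- x :: 'a alg_closure) ^ q = - (x ^ q)"
  using p q by (intro power_minus_odd) auto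

lemma of_nat_q: "of_nat q = (0 :: 'a alg_closure)"
proof -
  have "of_nat p = (0 :: 'a)" using of_nat_CHAR[where ?'a = 'a] char_eq by simp
  moreover have "k > 0" using q q_gt_2 by (intro Nat.gr0I) auto
  ultimately have "of_nat q = (0 :: 'a)" using q by simp
  then show ?thesis by (metis to_ac_0 to_ac_of_nat)
qed

text \<open>Since q vanishes in the closure, 2n = q + 1 becomes 1, and so 2 and n are invertible;
  this provides the simplicity of all roots counted below.\<close>

lemma of_nat_2n: "of_nat (2 * n) = (1 :: 'a alg_closure)"
  unfolding n by (simp add: of_nat_q)

lemma two_neq_0: "(2 :: 'a alg_closure) \<noteq> 0" and of_nat_n: "of_nat n \<noteq> (0 :: 'a alg_closure)"
  using of_nat_2n by auto

lemma one_neq_minus_1: "(1 :: 'a alg_closure) \<noteq> - 1"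
  using two_neq_0 by (simp add: eq_neg_iff_add_eq_0)

lemma c_primitive_root: "c \<in> primitive_roots (q - 1)"
proof -
  have K: "(UNIV :: 'a set) - {0} = {x. x ^ (q - 1) = 1}"
  proof -
    have "x \<noteq> 0 \<longleftrightarrow> x ^ (q - 1) = 1" for x :: 'a
    proof -
      have "x * x ^ (q - 1) = x"
        using finite_field_power_card_eq_same[of x] card q_gt_2 by (simp flip: power_Suc)
      then show ?thesis using q_gt_2 by (auto simp: power_0_left)
    qed
    then show ?thesis by auto
  qed
  show ?thesis
    using c generates_units_iff_primitive_root[OF _ K] q_gt_2 card
    by (simp add: primitive_element_def)
qed

text \<open>The power c^(n-1) squares to c^(q-1) = 1 but is not 1, since 0 < n - 1 < q - 1 and c has
  order q - 1; hence it is -1.\<close>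

lemma \<gamma>_neq_0: "\<gamma> \<noteq> 0" and \<gamma>_power_n: "\<gamma> ^ n = - \<gamma>"
proof -
  have prim: "c ^ m = 1 \<longleftrightarrow> q - 1 dvd m" for m
    using c_primitive_root by (simp add: primitive_roots_def)
  have q1: "q - 1 = 2 * (n - 1)" using n by simp
  have "(c ^ (n - 1))\<^sup>2 = 1"
    using prim[of "q - 1"] unfolding q1 by (simp add: mult.commute flip: power_mult)
  moreover have "c ^ (n - 1) \<noteq> 1"
    using prim[of "n - 1"] n_gt_1 dvd_imp_le[of "q - 1" "n - 1"] n by auto
  ultimately have "c ^ (n - 1) = - 1" by (simp add: power2_eq_1_iff)
  then have "c ^ n = - c"
    using n_gt_1 by (simp add: power_eq_if)
  then show "\<gamma> ^ n = - \<gamma>" unfolding \<gamma>_def by (metis to_ac_minus to_ac_power)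
  have "c \<noteq> 0"
    using \<open>c ^ (n - 1) = - 1\<close> n_gt_1 by (auto simp: power_0_left)
  then show "\<gamma> \<noteq> 0" by (simp add: \<gamma>_def)
qed

section \<open>Roots of X^2 + bX + c in the closure and the action of Frobenius\<close>

lemma root_iff: "poly [:\<gamma>, to_ac b, 1:] x = 0 \<longleftrightarrow> x \<noteq> 0 \<and> to_ac b = - (x + \<gamma> / x)"
proof (cases "x = 0")
  case False
  then have "poly [:\<gamma>, to_ac b, 1:] x = x * (to_ac b + (x + \<gamma> / x))"
    by (simp add: distrib_left mult.commute)
  with False show ?thesis
    unfolding eq_neg_iff_add_eq_0 by simp
qed (simp add: \<gamma>_neq_0)

lemma ex_root: "\<exists>x. x \<noteq> 0 \<and> to_ac b = - (x + \<gamma> / x)"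
proof -
  have "Polynomial.degree [:\<gamma>, to_ac b, 1:] > 0" by simp
  from alg_closed_imp_poly_has_root[OF this] show ?thesis
    unfolding root_iff .
qed

lemma same_trace_iff:
  assumes "x \<noteq> 0" "y \<noteq> 0"
  shows "x + \<gamma> / x = y + \<gamma> / y \<longleftrightarrow> x = y \<or> x = \<gamma> / y"
proof -
  have "x * (\<gamma> / x) = y * (\<gamma> / y)"
    using assms by simp
  then have "(x - y) * (x - \<gamma> / y) = x * ((x + \<gamma> / x) - (y + \<gamma> / y))"
    unfolding ring_distribs by (simp only: mult.commute) simp
  moreover have "x = y \<or> x = \<gamma> / y \<longleftrightarrow> (x - y) * (x - \<gamma> / y) = 0"
    by simp
  ultimately show ?thesis
    using assms by simp
qed

text \<open>As 2n = q + 1 and \<gamma>^n = -\<gamma>, the left side is -x^(q+1) / \<gamma>.\<close>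

lemma quotient_power_iff:
  assumes "x \<noteq> 0"
  shows "(x\<^sup>2 / \<gamma>) ^ n = - 1 \<longleftrightarrow> x ^ q = \<gamma> / x"
proof -
  have eq: "(x\<^sup>2 / \<gamma>) ^ n = - (x ^ q * x / \<gamma>)"
    by (simp add: power_divide \<gamma>_power_n n flip: power_mult)
  show ?thesis
    unfolding eq using assms \<gamma>_neq_0 by (simp add: field_simps)
qed

lemma frobenius_trace: "(- (x + \<gamma> / x)) ^ q = - (x ^ q + \<gamma> / x ^ q)"
proof -
  have "\<gamma> ^ q = \<gamma>" unfolding \<gamma>_def by (rule frobenius_to_ac)
  then show ?thesis
    unfolding frobenius_minus frobenius_add power_divide by simp
qed

text \<open>Frobenius exchanges x and \<gamma> / x, so it fixes their sum, which therefore lies in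
  F_q.\<close>

lemma norm_root_imp_coefficient:
  assumes x: "x \<noteq> 0" "x ^ q = \<gamma> / x"
  shows "\<exists>b. to_ac b = - (x + \<gamma> / x)"
proof -
  have "(- (x + \<gamma> / x)) ^ q = - (x + \<gamma> / x)"
    unfolding frobenius_trace using x \<gamma>_neq_0 by (simp add: add.commute)
  then have "- (x + \<gamma> / x) \<in> range to_ac"
    unfolding range_to_ac_eq card by simp
  then show ?thesis by (metis rangeE)
qed

text \<open>The \<open>b\<close> for which some (for \<open>Z\<close> closed under inversion: each) root \<open>x\<close> of \<open>X\<^sup>2 + bX + c\<close> has its
  quotient by the other root, \<open>x / (\<gamma> / x)\<close>, in \<open>Z\<close>.\<close>
definition coefficients :: "'a alg_closure set \<Rightarrow> 'a set"
  where "coefficients Z = {b. \<exists>x. x \<noteq> 0 \<and> to_ac b = - (x + \<gamma> / x) \<and> x\<^sup>2 / \<gamma> \<in> Z}"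

text \<open>Both \<open>x \<mapsto> x\<^sup>2 / \<gamma>\<close> and \<open>x \<mapsto> -(x + \<gamma> / x)\<close> are two-to-one on the \<open>x\<close> with \<open>x\<^sup>2 / \<gamma> \<in> Z\<close>.\<close>
lemma card_coefficients:
  assumes Z: "Z \<subseteq> {z. z ^ n = - 1}" and inv: "\<And>z. z \<in> Z \<Longrightarrow> inverse z \<in> Z"
  shows "card (coefficients Z) = card Z"
proof -
  define S where "S = {x. x\<^sup>2 / \<gamma> \<in> Z}"
  define t where "t = (\<lambda>x. - (x + \<gamma> / x))"
  have "card {z. z ^ n = (- 1 :: 'a alg_closure)} = n"
    using card_nth_roots[OF of_nat_n, of "- 1"] by simp
  then have "finite {z. z ^ n = (- 1 :: 'a alg_closure)}"
    using n_gt_1 by (intro card_ge_0_finite) simp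
  then have finZ: "finite Z" using Z finite_subset by blast
  have Z0: "z \<noteq> 0" if "z \<in> Z" for z
    using that Z n_gt_1 by (auto simp: power_0_left)
  have S0: "x \<noteq> 0" if "x \<in> S" for x
    using that Z0 by (force simp: S_def)
  have Sq: "x ^ q = \<gamma> / x" if "x \<in> S" for x
    using quotient_power_iff[OF S0[OF that]] that Z by (auto simp: S_def)
  have fib1: "card {x. x\<^sup>2 = \<gamma> * z} = 2" if "z \<in> Z" for z
    using card_nth_roots[of 2 "\<gamma> * z"] two_neq_0 \<gamma>_neq_0 Z0[OF that] by simp
  have finS: "finite S"
  proof -
    have "S \<subseteq> (\<Union>z\<in>Z. {x. x\<^sup>2 = \<gamma> * z})"
      using \<gamma>_neq_0 by (auto simp: S_def)
    moreover have "finite {x. x\<^sup>2 = \<gamma> * z}" if "z \<in> Z" for z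
      using fib1[OF that] by (intro card_ge_0_finite) simp
    ultimately show ?thesis using finZ by (meson finite_UN_I finite_subset)
  qed
  have "(\<lambda>x. x\<^sup>2 / \<gamma>) ` S = Z"
  proof
    show "Z \<subseteq> (\<lambda>x. x\<^sup>2 / \<gamma>) ` S"
    proof
      fix z assume z: "z \<in> Z"
      then obtain x where "x\<^sup>2 = \<gamma> * z"
        using nth_root_exists[of 2 "\<gamma> * z"] by auto
      then show "z \<in> (\<lambda>x. x\<^sup>2 / \<gamma>) ` S"
        using z \<gamma>_neq_0 by (auto simp: S_def intro!: image_eqI[of _ _ x])
    qed
  qed (auto simp: S_def)
  moreover have "card {y \<in> S. y\<^sup>2 / \<gamma> = x\<^sup>2 / \<gamma>} = 2" if x: "x \<in> S" for x
  proof -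
    have "{y \<in> S. y\<^sup>2 / \<gamma> = x\<^sup>2 / \<gamma>} = {y. y\<^sup>2 = \<gamma> * (x\<^sup>2 / \<gamma>)}"
      using x \<gamma>_neq_0 by (auto simp: S_def field_simps)
    then show ?thesis using fib1[of "x\<^sup>2 / \<gamma>"] x by (simp add: S_def)
  qed
  ultimately have 1: "card S = 2 * card Z"
    using card_eq_card_fibres[OF finS, of "\<lambda>x. x\<^sup>2 / \<gamma>" 2] by simp
  have "card {y \<in> S. t y = t x} = 2" if x: "x \<in> S" for x
  proof -
    have "(\<gamma> / x)\<^sup>2 / \<gamma> = inverse (x\<^sup>2 / \<gamma>)"
      using S0[OF x] \<gamma>_neq_0 by (simp add: field_simps power2_eq_square)
    \<comment> \<open>The other root has the inverse quotient, so closure of \<open>Z\<close> under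
      inversion keeps both roots in \<open>S\<close>.\<close>
    then have "\<gamma> / x \<in> S" using x inv[of "x\<^sup>2 / \<gamma>"] by (simp only: S_def mem_Collect_eq)
    moreover have "t y = t x \<longleftrightarrow> y = x \<or> y = \<gamma> / x" if "y \<in> S" for y
      unfolding t_def neg_equal_iff_equal by (rule same_trace_iff) (use S0 x that in auto)
    ultimately have "{y \<in> S. t y = t x} = {x, \<gamma> / x}"
      using x by blast
    \<comment> \<open>Equality would mean quotient 1, which z^n = -1 excludes in odd characteristic;
      so the fibre really has two points.\<close>
    moreover have "x \<noteq> \<gamma> / x"
    proof
      assume "x = \<gamma> / x"
      then have "x\<^sup>2 / \<gamma> = 1" using S0[OF x] \<gamma>_neq_0 by (simp add: field_simps power2_eq_square)
      then have "1 ^ n = (- 1 :: 'a alg_closure)" using x Z by (auto simp: S_def)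
      then show False using one_neq_minus_1 by simp
    qed
    ultimately show ?thesis by simp
  qed
  then have "card S = 2 * card (t ` S)"
    using card_eq_card_fibres[OF finS] by blast
  also have "t ` S = to_ac ` coefficients Z"
  proof
    show "t ` S \<subseteq> to_ac ` coefficients Z"
    proof clarify
      fix x assume x: "x \<in> S"
      obtain b where "to_ac b = t x"
        using norm_root_imp_coefficient[OF S0[OF x] Sq[OF x]] by (auto simp: t_def)
      then show "t x \<in> to_ac ` coefficients Z"
        using x S0[OF x] by (intro image_eqI[of _ _ b]) (auto simp: coefficients_def t_def S_def)
    qed
    show "to_ac ` coefficients Z \<subseteq> t ` S"
      by (auto simp: coefficients_def t_def S_def)
  qed
  also have "card \<dots> = card (coefficients Z)"
    by (rule card_image) (meson inj_to_ac inj_on_subset subset_UNIV)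
  finally show ?thesis using 1 by simp
qed

text \<open>Every b has a root x in the closure, so a criterion valid for an arbitrary root decides
  every b. Two properties with the same \<open>Z\<close> then define the same set.\<close>

lemma Collect_eq_coefficients:
  assumes "\<And>b x. x \<noteq> 0 \<Longrightarrow> to_ac b = - (x + \<gamma> / x) \<Longrightarrow> P b \<longleftrightarrow> x\<^sup>2 / \<gamma> \<in> Z"
  shows "{b. P b} = coefficients Z"
  unfolding coefficients_def using assms ex_root by blast

section \<open>The four sets of b: roots of the two polynomials, irreducible and primitive
  quadratics\<close>

lemma evaluation_morphism: "ring_morphism (\<lambda>P. to_ac (poly (subst_C P c) b))"
  by (intro ring_morphism_comp[OF to_ac_morphism] ring_morphism_comp[OF poly_eval_morphism]
      subst_C_morphism)

lemma evaluation_indet: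
  assumes "x \<noteq> 0" "to_ac b = - (x + \<gamma> / x)"
  shows "to_ac (poly (subst_C indet_B c) b) = - (x + \<gamma> / x)"
    "to_ac (poly (subst_C indet_C c) b) = x * (\<gamma> / x)"
  using assms by (simp_all only: subst_C_indet) (simp_all add: \<gamma>_def)

lemma roots_lucas_V: "{b. poly (subst_C (lucas_V n) c) b = 0} = coefficients {z. z ^ n = - 1}"
proof (rule Collect_eq_coefficients)
  fix b x assume x: "x \<noteq> 0" "to_ac b = - (x + \<gamma> / x)"
  have "to_ac (poly (subst_C (lucas_V n) c) b) = x ^ n + (\<gamma> / x) ^ n"
    by (rule lucas_V_morphism[OF evaluation_morphism evaluation_indet[OF x]])
  also have "\<dots> = (\<gamma> / x) ^ n * ((x\<^sup>2 / \<gamma>) ^ n + 1)"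
    using x \<gamma>_neq_0 by (simp add: distrib_left power2_eq_square flip: power_mult_distrib)
  finally have "to_ac (poly (subst_C (lucas_V n) c) b) = 0 \<longleftrightarrow> (x\<^sup>2 / \<gamma>) ^ n + 1 = 0"
    using x \<gamma>_neq_0 by simp
  then show "poly (subst_C (lucas_V n) c) b = 0 \<longleftrightarrow> x\<^sup>2 / \<gamma> \<in> {z. z ^ n = - 1}"
    by (simp only: to_ac_eq_0_iff mem_Collect_eq eq_neg_iff_add_eq_0)
qed

lemma roots_lucas_atom:
  "{b. poly (subst_C (lucas_atom (2 * n)) c) b = 0} = coefficients (primitive_roots (2 * n))"
proof (rule Collect_eq_coefficients)
  fix b x assume x: "x \<noteq> 0" "to_ac b = - (x + \<gamma> / x)"
  have gt: "2 * n > 2" and nz: "of_nat (2 * n) \<noteq> (0 :: 'a alg_closure)"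
    using n_gt_1 of_nat_2n by simp_all
  have "to_ac (poly (subst_C (lucas_atom (2 * n)) c) b) = cyclotomic_hom (2 * n) x (\<gamma> / x)"
    unfolding lucas_atom_eq_expansion[OF gt]
    by (rule lucas_atom_expansion_morphism[OF gt evaluation_morphism evaluation_indet[OF x]])
       (use x \<gamma>_neq_0 in simp)
  also have "\<dots> = 0 \<longleftrightarrow> poly (cyclotomic (2 * n)) (x\<^sup>2 / \<gamma>) = 0"
    using x \<gamma>_neq_0 by (simp add: cyclotomic_hom_def power2_eq_square)
  finally show "poly (subst_C (lucas_atom (2 * n)) c) b = 0 \<longleftrightarrow> x\<^sup>2 / \<gamma> \<in> primitive_roots (2 * n)"
    by (simp only: to_ac_eq_0_iff poly_cyclotomic_eq_0_iff[OF nz])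
qed

lemma primitive_roots_2n: "z \<in> primitive_roots (2 * n) \<Longrightarrow> z ^ n = (- 1 :: 'a alg_closure)"
proof -
  assume z: "z \<in> primitive_roots (2 * n)"
  then have "(z ^ n)\<^sup>2 = 1" "z ^ n \<noteq> 1"
    using n_gt_1 by (auto simp: primitive_roots_def mult.commute dest: dvd_imp_le simp flip: power_mult)
  then show ?thesis by (simp add: power2_eq_1_iff)
qed

text \<open>Frobenius fixes b and c, so x^q is again a root, that is, x or \<gamma> / x.\<close>

lemma conjugate_root:
  assumes x: "x \<noteq> 0" "to_ac b = - (x + \<gamma> / x)" and "x ^ q \<noteq> x"
  shows "x ^ q = \<gamma> / x"
proof -
  have "x ^ q + \<gamma> / x ^ q = x + \<gamma> / x"
    using frobenius_to_ac[of b] unfolding x(2) frobenius_trace neg_equal_iff_equal .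
  then show ?thesis
    using same_trace_iff[of "x ^ q" x] x assms by simp
qed

lemma irreducible_coefficients:
  "{b. Factorial_Ring.irreducible [:c, b, 1:]} = coefficients {z. z ^ n = - 1}"
proof (rule Collect_eq_coefficients)
  fix b x assume x: "x \<noteq> 0" "to_ac b = - (x + \<gamma> / x)"
  have root: "poly [:c, b, 1:] r = 0 \<longleftrightarrow> poly [:\<gamma>, to_ac b, 1:] (to_ac r) = 0" for r
  proof -
    have "poly [:\<gamma>, to_ac b, 1:] (to_ac r) = to_ac (poly [:c, b, 1:] r)"
      by (simp add: \<gamma>_def)
    then show ?thesis by (simp only: to_ac_eq_0_iff)
  qed
  have "Factorial_Ring.irreducible [:c, b, 1:] \<longleftrightarrow> x ^ q = \<gamma> / x"
    unfolding irreducible_quadratic_iff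
  proof
    assume noroot: "\<forall>r. poly [:c, b, 1:] r \<noteq> 0"
    have "x \<notin> range (to_ac :: 'a \<Rightarrow> _)"
      using noroot x root root_iff by blast
    then have "x ^ q \<noteq> x"
      unfolding range_to_ac_eq card by simp
    then show "x ^ q = \<gamma> / x" by (rule conjugate_root[OF x])
  next
    assume xq: "x ^ q = \<gamma> / x"
    show "\<forall>r. poly [:c, b, 1:] r \<noteq> 0"
    proof (intro allI notI)
      fix r assume "poly [:c, b, 1:] r = 0"
      then have r: "to_ac r \<noteq> 0" "to_ac r + \<gamma> / to_ac r = x + \<gamma> / x"
        unfolding root root_iff using x(2) neg_equal_iff_equal by metis+
      \<comment> \<open>Frobenius exchanges the two roots but fixes r, which is one of them; hence
        they coincide, their quotient is 1, and z^n = -1 fails.\<close>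
      have "(\<gamma> / x) ^ q = x"
        using xq x \<gamma>_neq_0 frobenius_to_ac[of c] by (simp add: power_divide \<gamma>_def)
      then have "x = \<gamma> / x"
        using frobenius_to_ac[of r] xq r same_trace_iff[OF r(1) x(1)] by auto
      then have "x\<^sup>2 / \<gamma> = 1"
        using x \<gamma>_neq_0 by (simp add: field_simps power2_eq_square)
      then show False
        using quotient_power_iff[OF x(1)] xq one_neq_minus_1 by simp
    qed
  qed
  then show "Factorial_Ring.irreducible [:c, b, 1:] \<longleftrightarrow> x\<^sup>2 / \<gamma> \<in> {z. z ^ n = - 1}"
    using quotient_power_iff[OF x(1)] by simp
qed

lemma generates_field_extension_iff:
  "generates_units (field_extension 2 :: 'a alg_closure set) y \<longleftrightarrow> y \<in> primitive_roots (q\<^sup>2 - 1)"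
proof -
  have q2: "q\<^sup>2 > 1" using q_gt_2 by (intro one_less_power) simp_all
  have K: "field_extension 2 - {0} = {y :: 'a alg_closure. y ^ (q\<^sup>2 - 1) = 1}"
  proof -
    have "q\<^sup>2 = Suc (q\<^sup>2 - 1)" using q2 by simp
    then have "y ^ q\<^sup>2 = y * y ^ (q\<^sup>2 - 1)" for y :: "'a alg_closure"
      by (metis power_Suc)
    then show ?thesis
      using q2 by (auto simp: field_extension_def card power_0_left)
  qed
  \<comment> \<open>In characteristic p this exponent is invertible, so the roots of unity are as
    many as the exponent says.\<close>
  have "of_nat (q\<^sup>2 - 1) = (- 1 :: 'a alg_closure)"
    using q2 of_nat_q by (simp add: of_nat_diff)
  then have "card {y :: 'a alg_closure. y ^ (q\<^sup>2 - 1) = 1} = q\<^sup>2 - 1"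
    by (intro card_nth_roots) simp_all
  then show ?thesis
    using generates_units_iff_primitive_root[OF _ K] q2 K by simp
qed

lemma primitive_root_iff_quotient:
  assumes x: "x \<noteq> 0" "x ^ q = \<gamma> / x"
  shows "x \<in> primitive_roots (q\<^sup>2 - 1) \<longleftrightarrow> x\<^sup>2 / \<gamma> \<in> primitive_roots (2 * n)"
proof -
  have q2: "q\<^sup>2 - 1 = (q - 1) * (2 * n)"
    unfolding n using q_gt_2 by (simp add: power2_eq_square algebra_simps)
  have "x * x ^ (q - 1) = \<gamma> / x"
    using x q_gt_2 by (simp add: power_eq_if)
  then have z: "x ^ (q - 1) = inverse (x\<^sup>2 / \<gamma>)"
    using x by (simp add: field_simps power2_eq_square)
  have zm: "x ^ ((q - 1) * j) = 1 \<longleftrightarrow> (x\<^sup>2 / \<gamma>) ^ j = 1" for j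
    unfolding power_mult z power_inverse by simp
  show ?thesis
  proof
    assume prim: "x \<in> primitive_roots (q\<^sup>2 - 1)"
    have "(x\<^sup>2 / \<gamma>) ^ j = 1 \<longleftrightarrow> 2 * n dvd j" for j
      using prim q_gt_2 unfolding zm[symmetric] primitive_roots_def q2 by simp
    then show "x\<^sup>2 / \<gamma> \<in> primitive_roots (2 * n)" by (simp add: primitive_roots_def)
  next
    assume prim: "x\<^sup>2 / \<gamma> \<in> primitive_roots (2 * n)"
    have "x ^ m = 1 \<longleftrightarrow> q\<^sup>2 - 1 dvd m" for m
    proof
      assume "q\<^sup>2 - 1 dvd m"
      then obtain i where i: "m = (q - 1) * (2 * n * i)" unfolding q2 by (metis dvdE mult.assoc)
      show "x ^ m = 1" unfolding i zm using prim by (simp add: primitive_roots_def)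
    next
      assume m: "x ^ m = 1"
      \<comment> \<open>Here the primitivity of c enters: x^m = 1 gives c^m = 1, so q - 1 divides m,
        and the order of the quotient then controls the cofactor j.\<close>
      have "\<gamma> = x ^ q * x" using x by simp
      then have "\<gamma> ^ m = (x ^ m) ^ q * x ^ m"
        by (simp add: power_mult_distrib mult.commute flip: power_mult)
      then have "to_ac (c ^ m) = to_ac 1" using m by (simp add: \<gamma>_def)
      then have "c ^ m = 1" unfolding to_ac_eq_iff .
      then obtain j where j: "m = (q - 1) * j"
        using c_primitive_root by (auto simp: primitive_roots_def)
      have "2 * n dvd j" using m prim unfolding j zm by (simp add: primitive_roots_def)
      then show "q\<^sup>2 - 1 dvd m" unfolding q2 j by simp
    qed
    then show "x \<in> primitive_roots (q\<^sup>2 - 1)" by (simp add: primitive_roots_def)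
  qed
qed

lemma inverse_primitive_roots: "z \<in> primitive_roots m \<longleftrightarrow> inverse z \<in> primitive_roots m"
  by (simp add: primitive_roots_def power_inverse)

lemma primitive_coefficients:
  "{b. primitive_polynomial [:c, b, 1:]} = coefficients (primitive_roots (2 * n))"
proof (rule Collect_eq_coefficients)
  fix b x assume x: "x \<noteq> 0" "to_ac b = - (x + \<gamma> / x)"
  have map: "map_poly to_ac [:c, b, 1:] = [:\<gamma>, to_ac b, 1:]"
    by (simp add: map_poly_pCons \<gamma>_def)
  have deg: "Polynomial.degree [:c, b, 1:] = 2" by simp
  show "primitive_polynomial [:c, b, 1:] \<longleftrightarrow> x\<^sup>2 / \<gamma> \<in> primitive_roots (2 * n)"
  proof
    assume "primitive_polynomial [:c, b, 1:]"
    then obtain y where "generates_units (field_extension 2) y" "is_minimal_polynomial [:c, b, 1:] y"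
      unfolding primitive_polynomial_def deg by blast
    then have prim: "y \<in> primitive_roots (q\<^sup>2 - 1)" and root: "poly [:\<gamma>, to_ac b, 1:] y = 0"
      unfolding generates_field_extension_iff is_minimal_polynomial_def map by blast+
    have y: "y \<noteq> 0" "to_ac b = - (y + \<gamma> / y)"
      using root unfolding root_iff by blast+
    \<comment> \<open>The order q^2 - 1 of y is too large to divide q - 1, so y lies outside
      F_q.\<close>
    have "y ^ q \<noteq> y"
    proof
      assume "y ^ q = y"
      then have "y ^ (q - 1) = 1" using y(1) q_gt_2 by (simp add: power_eq_if)
      then have "q\<^sup>2 - 1 dvd q - 1" using prim by (simp add: primitive_roots_def)
      then have "q\<^sup>2 - 1 \<le> q - 1" using q_gt_2 by (intro dvd_imp_le) auto
      moreover have "q < q\<^sup>2" using q_gt_2 by (simp add: power2_eq_square)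
      ultimately show False using q_gt_2 by linarith
    qed
    then have "y ^ q = \<gamma> / y" by (rule conjugate_root[OF y])
    then have "y\<^sup>2 / \<gamma> \<in> primitive_roots (2 * n)"
      using primitive_root_iff_quotient[OF y(1)] prim by simp
    \<comment> \<open>The given root x need not be the generator y supplied by primitivity; passing
      to the other root inverts the quotient and preserves its order.\<close>
    moreover have "x = y \<or> x = \<gamma> / y"
      using same_trace_iff[OF x(1) y(1)] x(2) y(2) neg_equal_iff_equal by metis
    moreover have "(\<gamma> / y)\<^sup>2 / \<gamma> = inverse (y\<^sup>2 / \<gamma>)"
      using y(1) \<gamma>_neq_0 by (simp add: field_simps power2_eq_square)
    ultimately show "x\<^sup>2 / \<gamma> \<in> primitive_roots (2 * n)"
      using inverse_primitive_roots[of "y\<^sup>2 / \<gamma>"] by auto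
  next
    assume z: "x\<^sup>2 / \<gamma> \<in> primitive_roots (2 * n)"
    then have xq: "x ^ q = \<gamma> / x"
      using primitive_roots_2n quotient_power_iff[OF x(1)] by blast
    have gen: "generates_units (field_extension 2) x"
      unfolding generates_field_extension_iff primitive_root_iff_quotient[OF x(1) xq] by (rule z)
    have "x ^ q \<noteq> x"
    proof
      assume "x ^ q = x"
      then have "x\<^sup>2 / \<gamma> = 1" using xq x(1) \<gamma>_neq_0 by (simp add: field_simps power2_eq_square)
      then show False using primitive_roots_2n[OF z] one_neq_minus_1 by simp
    qed
    then have notin: "x \<notin> range (to_ac :: 'a \<Rightarrow> _)"
      unfolding range_to_ac_eq card by simp
    \<comment> \<open>A nonzero polynomial of degree at most 1 over F_q has no root outside
      F_q.\<close>
    have "2 \<le> Polynomial.degree g" if g: "g \<noteq> 0" "poly (map_poly to_ac g) x = 0" for g :: "'a poly"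
    proof (rule ccontr)
      assume small: "\<not> 2 \<le> Polynomial.degree g"
      obtain u g' where g': "g = pCons u g'" by (cases g)
      then have "Polynomial.degree g' = 0" using small by (auto split: if_splits)
      then obtain v where uv: "g = [:u, v:]" using g' by (auto elim: degree_eq_zeroE)
      then have eq: "to_ac u + x * to_ac v = 0"
        using g(2) by (simp add: map_poly_pCons)
      show False
      proof (cases "v = 0")
        case True
        then show ?thesis using eq uv g(1) by simp
      next
        case False
        then have "x = to_ac (- u / v)"
          using eq by (simp add: field_simps eq_neg_iff_add_eq_0)
        then show ?thesis using notin by blast
      qed
    qed
    then have "is_minimal_polynomial [:c, b, 1:] x"
      unfolding is_minimal_polynomial_def map root_iff deg using x
      by (simp add: numeral_2_eq_2 del: minus_add_distrib)
    then show "primitive_polynomial [:c, b, 1:]"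
      unfolding primitive_polynomial_def deg using gen by (auto simp: numeral_2_eq_2)
  qed
qed

section \<open>Cardinalities and the product formula\<close>

lemma card_irreducible_coefficients: "card (coefficients {z. z ^ n = - 1}) = n"
proof -
  have "card (coefficients {z. z ^ n = - 1}) = card {z. z ^ n = (- 1 :: 'a alg_closure)}"
    by (rule card_coefficients) (auto simp: power_inverse)
  then show ?thesis using card_nth_roots[OF of_nat_n, of "- 1"] by simp
qed

lemma card_primitive_coefficients: "card (coefficients (primitive_roots (2 * n))) = totient (2 * n)"
proof -
  have "card (coefficients (primitive_roots (2 * n))) = card (primitive_roots (2 * n) :: 'a alg_closure set)"
    by (rule card_coefficients) (use primitive_roots_2n inverse_primitive_roots in auto)
  also have "\<dots> = totient (2 * n)"
    by (rule card_primitive_roots) (simp only: of_nat_2n one_neq_zero not_False_eq_True)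
  finally show ?thesis .
qed

text \<open>The roots found in F_q are as many as the degree, so the monic polynomial splits over
  them and has no further roots in any extension.\<close>

lemma subst_C_lucas_atom_eq_prod:
  "subst_C (lucas_atom (2 * n)) c = (\<Prod>b | primitive_polynomial [:c, b, 1:]. [:- b, 1:])"
proof (rule monic_eq_prod_roots)
  show "card {b. primitive_polynomial [:c, b, 1:]} = Polynomial.degree (subst_C (lucas_atom (2 * n)) c)"
    using subst_C_lucas_atom(1)[of "2 * n" c] n_gt_1
    by (simp add: primitive_coefficients card_primitive_coefficients)
  show "poly (subst_C (lucas_atom (2 * n)) c) b = 0" if "b \<in> {b. primitive_polynomial [:c, b, 1:]}" for b
    using that unfolding primitive_coefficients roots_lucas_atom[symmetric] by simp
qed (use subst_C_lucas_atom(2)[of "2 * n" c] n_gt_1 in simp_all)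

end

theorem theorem5p4:
  fixes p k q N :: nat
    and I\<^sub>q P\<^sub>q :: "'a::finite_field poly poly"
  assumes "Factorial_Ring.prime p" and "odd p" and "k \<ge> 1" and "q = p ^ k"
    and "CARD('a) = q"
    and "N = q + 1"
    and "I\<^sub>q = (-1) ^ (N div 2) * lucas_V (N div 2)"
    and "P\<^sub>q = lucas_atom N"
  shows "(\<forall>c::'a. primitive_element c \<longrightarrow>
            (card {b. poly (subst_C I\<^sub>q c) b = 0} = N div 2 \<and>
             {b. poly (subst_C I\<^sub>q c) b = 0} = {b. Factorial_Ring.irreducible [:c, b, 1:]}) \<and>
            (card {b. poly (subst_C P\<^sub>q c) b = 0} = totient N \<and>
             {b. poly (subst_C P\<^sub>q c) b = 0} = {b. primitive_polynomial [:c, b, 1:]})) \<and>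
         optimal_determining_polynomial P\<^sub>q"
proof -
  have "odd q" using assms(2,4) by simp
  then have n: "2 * (N div 2) = q + 1" using assms(6) by presburger
  have N: "2 * (N div 2) = N" using n assms(6) by simp
  have main: "(card {b. poly (subst_C I\<^sub>q c) b = 0} = N div 2 \<and>
       {b. poly (subst_C I\<^sub>q c) b = 0} = {b. Factorial_Ring.irreducible [:c, b, 1:]}) \<and>
      (card {b. poly (subst_C P\<^sub>q c) b = 0} = totient N \<and>
       {b. poly (subst_C P\<^sub>q c) b = 0} = {b. primitive_polynomial [:c, b, 1:]}) \<and>
      subst_C P\<^sub>q c = (\<Prod>b | primitive_polynomial [:c, b, 1:]. [:- b, 1:])"
    if c: "primitive_element c" for c :: 'a
  proof -
    interpret odd_finite_field p k q "N div 2" c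
      by standard (use assms n c in auto)
    interpret ring_morphism "\<lambda>P. poly (subst_C P c) b" for b
      by (intro ring_morphism_comp[OF poly_eval_morphism] subst_C_morphism)
    \<comment> \<open>The sign is a unit, so both polynomials have the same roots.\<close>
    have "poly (subst_C I\<^sub>q c) b = 0 \<longleftrightarrow> poly (subst_C (lucas_V (N div 2)) c) b = 0" for b
      unfolding assms(7) hom_mult hom_power hom_uminus hom_one by simp
    then show ?thesis
      using roots_lucas_V irreducible_coefficients card_irreducible_coefficients
        roots_lucas_atom primitive_coefficients card_primitive_coefficients subst_C_lucas_atom_eq_prod
      unfolding N assms(8) by simp
  qed
  moreover have "optimal_determining_polynomial P\<^sub>q"
    unfolding optimal_determining_polynomial_def
  proof (intro allI impI conjI)
    fix c :: 'a assume c: "primitive_element c"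
    have eq: "subst_C P\<^sub>q c = (\<Prod>b | primitive_polynomial [:c, b, 1:]. [:- b, 1:])"
      using main[OF c] by blast
    show "Polynomial.lead_coeff (subst_C P\<^sub>q c) = 1"
      unfolding eq by (simp add: lead_coeff_prod)
    show "squarefree (subst_C P\<^sub>q c)"
      unfolding eq by (rule squarefree_prod_linear) simp
    show "{b. poly (subst_C P\<^sub>q c) b = 0} = {b. primitive_polynomial [:c, b, 1:]}"
      using main[OF c] by blast
    show "subst_C P\<^sub>q c = (\<Prod>b | primitive_polynomial [:c, b, 1:]. [:- b, 1:])"
      by (rule eq)
  qed
  ultimately show ?thesis by blast
qed

end
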